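(* Let $\mathcal{E}$ be a locally presentable and locally cartesian closed category equipped with a functorial cylinder $I\otimes(-)$ with contractions and connections such that $I\otimes(-)$ has a right adjoint. Let $(\mathsf{Cof},\mathsf{TrivFib})$ be a suitable weak factorization system on $\mathcal{E}$, cofibrantly generated by a set of maps $\mathcal{I}$. Let $\mathcal{I}_\otimes=\{\delta^k\hat\otimes i \mid k\in\{0,1\},\ i\in\mathcal{I}\}$, let $\mathsf{Fib}$ be the class of maps with the right lifting property with respect to all maps in $\mathcal{I}_\otimes$, and let $\mathsf{TrivCof}$ be the class of maps with the left lifting property with respect to all maps in $\mathsf{Fib}$. Then the weak factorization system $(\mathsf{TrivCof},\mathsf{Fib})$ has the Frobenius property, i.e. the pullback of a map in $\mathsf{TrivCof}$ along a map in $\mathsf{Fib}$ is again in $\mathsf{TrivCof}$.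
   Context: A functorial cylinder on $\mathcal{E}$ is an endofunctor $I\otimes(-)$ of $\mathcal{E}$ with natural transformations $\delta^0\otimes(-),\delta^1\otimes(-)\colon \mathrm{Id}\to I\otimes(-)$ (the endpoint inclusions). It has contractions if there is a natural transformation $\varepsilon\otimes(-)\colon I\otimes(-)\to\mathrm{Id}$ with $(\varepsilon\otimes X)\circ(\delta^k\otimes X)=\mathrm{id}_X$ for $k=0,1$. It then has connections if for $k\in\{0,1\}$ there is a natural transformation $c^k\otimes(-)\colon I\otimes I\otimes(-)\to I\otimes(-)$ (where $I\otimes I\otimes X=I\otimes(I\otimes X)$) such that $(c^k\otimes X)\circ(\delta^k\otimes I\otimes X)=(\delta^k\otimes X)\circ(\varepsilon\otimes X)=(c^k\otimes X)\circ(I\otimes\delta^k\otimes X)$ and $(c^k\otimes X)\circ(\delta^{1-k}\otimes I\otimes X)=\mathrm{id}_{I\otimes X}=(c^k\otimes X)\circ(I\otimes\delta^{1-k}\otimes X)$; here $\delta^k\otimes I\otimes X$ is the component at $I\otimes X$, and $I\otimes\delta^k\otimes X$ is $I\otimes(-)$ applied to the component at $X$. For $i\colon A\to B$ the Leibniz product $\delta^k\hat\otimes i\colon (I\otimes A)+_A B\to I\otimes B$ is the map out of the pushout of $\delta^k\otimes A\colon A\to I\otimes A$ and $i\colon A\to B$ induced by $I\otimes i$ and $\delta^k\otimes B$. A weak factorization system (wfs) is cofibrantly generated by a set $\mathcal{I}$ if its right class consists of the maps with the right lifting property against $\mathcal{I}$. A wfs $(\mathsf{Cof},\mathsf{TrivFib})$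 is suitable if: (S1) it is cofibrantly generated (by a set); (S2) for every $X\in\mathcal{E}$ the map $0\to X$ is in $\mathsf{Cof}$; (S3) $\mathsf{Cof}$ is closed under pullback along arbitrary maps; (S4) if $i\in\mathsf{Cof}$ then $\delta^k\hat\otimes i\in\mathsf{Cof}$ for $k\in\{0,1\}$. The pair $(\mathsf{TrivCof},\mathsf{Fib})$ is a wfs by the small object argument. *)

theory Defs
  imports Main
begin

unbundle cardinal_syntax

section \<open>Categories, functors, natural transformations\<close>

record ('o, 'a) cat =
  obj :: "'o set"
  arr :: "'a set"
  src :: "'a \<Rightarrow> 'o"
  tgt :: "'a \<Rightarrow> 'o"
  idn :: "'o \<Rightarrow> 'a"
  cmp :: "'a \<Rightarrow> 'a \<Rightarrow> 'a"  (infixr \<open>\<cdot>\<index>\<close> 70)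

definition hom :: "('o, 'a) cat \<Rightarrow> 'o \<Rightarrow> 'o \<Rightarrow> 'a set" where
  "hom C X Y = {f \<in> arr C. src C f = X \<and> tgt C f = Y}"

definition category :: "('o, 'a) cat \<Rightarrow> bool" where
  "category C \<longleftrightarrow>
     (\<forall>f\<in>arr C. src C f \<in> obj C \<and> tgt C f \<in> obj C) \<and>
     (\<forall>X\<in>obj C. idn C X \<in> hom C X X) \<and>
     (\<forall>X Y Z f g. f \<in> hom C X Y \<longrightarrow> g \<in> hom C Y Z \<longrightarrow> g \<cdot>\<^bsub>C\<^esub> f \<in> hom C X Z) \<and>
     (\<forall>X Y f. f \<in> hom C X Y \<longrightarrow> f \<cdot>\<^bsub>C\<^esub> idn C X = f \<and> idn C Y \<cdot>\<^bsub>C\<^esub> f = f) \<and>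
     (\<forall>W X Y Z f g h. f \<in> hom C W X \<longrightarrow> g \<in> hom C X Y \<longrightarrow> h \<in> hom C Y Z \<longrightarrow>
        (h \<cdot>\<^bsub>C\<^esub> g) \<cdot>\<^bsub>C\<^esub> f = h \<cdot>\<^bsub>C\<^esub> (g \<cdot>\<^bsub>C\<^esub> f))"

record ('o, 'a, 'p, 'b) cfunctor =
  fob :: "'o \<Rightarrow> 'p"
  far :: "'a \<Rightarrow> 'b"

definition is_functor :: "('o, 'a) cat \<Rightarrow> ('p, 'b) cat \<Rightarrow> ('o, 'a, 'p, 'b) cfunctor \<Rightarrow> bool" where
  "is_functor C D F \<longleftrightarrow>
     (\<forall>X\<in>obj C. fob F X \<in> obj D) \<and>
     (\<forall>X Y f. f \<in> hom C X Y \<longrightarrow> far F f \<in> hom D (fob F X) (fob F Y)) \<and>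
     (\<forall>X\<in>obj C. far F (idn C X) = idn D (fob F X)) \<and>
     (\<forall>X Y Z f g. f \<in> hom C X Y \<longrightarrow> g \<in> hom C Y Z \<longrightarrow>
        far F (g \<cdot>\<^bsub>C\<^esub> f) = far F g \<cdot>\<^bsub>D\<^esub> far F f)"

definition id_functor :: "('o, 'a, 'o, 'a) cfunctor" where
  "id_functor = \<lparr>fob = (\<lambda>X. X), far = (\<lambda>f. f)\<rparr>"

definition comp_functor ::
    "('p, 'b, 'q, 'c) cfunctor \<Rightarrow> ('o, 'a, 'p, 'b) cfunctor \<Rightarrow> ('o, 'a, 'q, 'c) cfunctor" where
  "comp_functor G F = \<lparr>fob = (\<lambda>X. fob G (fob F X)), far = (\<lambda>f. far G (far F f))\<rparr>"

definition nat_trans :: "('o, 'a) cat \<Rightarrow> ('p, 'b) cat \<Rightarrow> ('o, 'a, 'p, 'b) cfunctor \<Rightarrow>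
    ('o, 'a, 'p, 'b) cfunctor \<Rightarrow> ('o \<Rightarrow> 'b) \<Rightarrow> bool" where
  "nat_trans C D F G t \<longleftrightarrow>
     is_functor C D F \<and> is_functor C D G \<and>
     (\<forall>X\<in>obj C. t X \<in> hom D (fob F X) (fob G X)) \<and>
     (\<forall>X Y f. f \<in> hom C X Y \<longrightarrow> t Y \<cdot>\<^bsub>D\<^esub> far F f = far G f \<cdot>\<^bsub>D\<^esub> t X)"

definition has_right_adjoint :: "('o, 'a) cat \<Rightarrow> ('p, 'b) cat \<Rightarrow> ('o, 'a, 'p, 'b) cfunctor \<Rightarrow> bool" where
  "has_right_adjoint C D F \<longleftrightarrow>
     (\<exists>G \<eta> \<theta>.
        nat_trans C C id_functor (comp_functor G F) \<eta> \<and>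
        nat_trans D D (comp_functor F G) id_functor \<theta> \<and>
        is_functor C D F \<and> is_functor D C G \<and>
        (\<forall>X\<in>obj C. \<theta> (fob F X) \<cdot>\<^bsub>D\<^esub> far F (\<eta> X) = idn D (fob F X)) \<and>
        (\<forall>Y\<in>obj D. far G (\<theta> Y) \<cdot>\<^bsub>C\<^esub> \<eta> (fob G Y) = idn C (fob G Y)))"


section \<open>Limits and colimits\<close>

definition is_initial :: "('o, 'a) cat \<Rightarrow> 'o \<Rightarrow> bool" where
  "is_initial C Z \<longleftrightarrow> Z \<in> obj C \<and> (\<forall>X\<in>obj C. \<exists>!f. f \<in> hom C Z X)"

definition is_terminal :: "('o, 'a) cat \<Rightarrow> 'o \<Rightarrow> bool" where
  "is_terminal C T \<longleftrightarrow> T \<in> obj C \<and> (\<forall>X\<in>obj C. \<exists>!f. f \<in> hom C X T)"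

definition is_product :: "('o, 'a) cat \<Rightarrow> 'o \<Rightarrow> 'o \<Rightarrow> 'o \<Rightarrow> 'a \<Rightarrow> 'a \<Rightarrow> bool" where
  "is_product C A B P p q \<longleftrightarrow>
     p \<in> hom C P A \<and> q \<in> hom C P B \<and>
     (\<forall>X f g. f \<in> hom C X A \<longrightarrow> g \<in> hom C X B \<longrightarrow>
        (\<exists>!h. h \<in> hom C X P \<and> p \<cdot>\<^bsub>C\<^esub> h = f \<and> q \<cdot>\<^bsub>C\<^esub> h = g))"

text \<open>\<open>P\<close>, with \<open>p : P \<rightarrow> src f\<close> and \<open>q : P \<rightarrow> src g\<close>, is a pullback of the cospan \<open>f, g\<close>.\<close>

definition is_pullback :: "('o, 'a) cat \<Rightarrow> 'a \<Rightarrow> 'a \<Rightarrow> 'o \<Rightarrow> 'a \<Rightarrow> 'a \<Rightarrow> bool" where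
  "is_pullback C f g P p q \<longleftrightarrow>
     f \<in> arr C \<and> g \<in> arr C \<and> tgt C f = tgt C g \<and>
     p \<in> hom C P (src C f) \<and> q \<in> hom C P (src C g) \<and> f \<cdot>\<^bsub>C\<^esub> p = g \<cdot>\<^bsub>C\<^esub> q \<and>
     (\<forall>X u v. u \<in> hom C X (src C f) \<longrightarrow> v \<in> hom C X (src C g) \<longrightarrow> f \<cdot>\<^bsub>C\<^esub> u = g \<cdot>\<^bsub>C\<^esub> v \<longrightarrow>
        (\<exists>!h. h \<in> hom C X P \<and> p \<cdot>\<^bsub>C\<^esub> h = u \<and> q \<cdot>\<^bsub>C\<^esub> h = v))"

text \<open>\<open>P\<close>, with \<open>p : tgt f \<rightarrow> P\<close> and \<open>q : tgt g \<rightarrow> P\<close>, is a pushout of the span \<open>f, g\<close>.\<close>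

definition is_pushout :: "('o, 'a) cat \<Rightarrow> 'a \<Rightarrow> 'a \<Rightarrow> 'o \<Rightarrow> 'a \<Rightarrow> 'a \<Rightarrow> bool" where
  "is_pushout C f g P p q \<longleftrightarrow>
     f \<in> arr C \<and> g \<in> arr C \<and> src C f = src C g \<and>
     p \<in> hom C (tgt C f) P \<and> q \<in> hom C (tgt C g) P \<and> p \<cdot>\<^bsub>C\<^esub> f = q \<cdot>\<^bsub>C\<^esub> g \<and>
     (\<forall>X u v. u \<in> hom C (tgt C f) X \<longrightarrow> v \<in> hom C (tgt C g) X \<longrightarrow> u \<cdot>\<^bsub>C\<^esub> f = v \<cdot>\<^bsub>C\<^esub> g \<longrightarrow>
        (\<exists>!h. h \<in> hom C P X \<and> h \<cdot>\<^bsub>C\<^esub> p = u \<and> h \<cdot>\<^bsub>C\<^esub> q = v))"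

definition is_cocone :: "('i, 'j) cat \<Rightarrow> ('o, 'a) cat \<Rightarrow> ('i, 'j, 'o, 'a) cfunctor \<Rightarrow>
    'o \<Rightarrow> ('i \<Rightarrow> 'a) \<Rightarrow> bool" where
  "is_cocone J C F X \<iota> \<longleftrightarrow>
     X \<in> obj C \<and> (\<forall>j\<in>obj J. \<iota> j \<in> hom C (fob F j) X) \<and>
     (\<forall>i j u. u \<in> hom J i j \<longrightarrow> \<iota> j \<cdot>\<^bsub>C\<^esub> far F u = \<iota> i)"

definition is_colimit :: "('i, 'j) cat \<Rightarrow> ('o, 'a) cat \<Rightarrow> ('i, 'j, 'o, 'a) cfunctor \<Rightarrow>
    'o \<Rightarrow> ('i \<Rightarrow> 'a) \<Rightarrow> bool" where
  "is_colimit J C F X \<iota> \<longleftrightarrow>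
     is_functor J C F \<and> is_cocone J C F X \<iota> \<and>
     (\<forall>Y \<tau>. is_cocone J C F Y \<tau> \<longrightarrow>
        (\<exists>!h. h \<in> hom C X Y \<and> (\<forall>j\<in>obj J. h \<cdot>\<^bsub>C\<^esub> \<iota> j = \<tau> j)))"


section \<open>Locally cartesian closed categories\<close>

text \<open>\<open>E\<close> with \<open>ev : E \<times> A \<rightarrow> B\<close> is an exponential of \<open>B\<close> by \<open>A\<close>, where \<open>P, p, q\<close> is the product
  \<open>E \<times> A\<close>. The arrow \<open>m\<close> below is \<open>g \<times> A\<close>.\<close>

definition is_exponential ::
    "('o, 'a) cat \<Rightarrow> 'o \<Rightarrow> 'o \<Rightarrow> 'o \<Rightarrow> 'o \<Rightarrow> 'a \<Rightarrow> 'a \<Rightarrow> 'a \<Rightarrow> bool" where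
  "is_exponential C A B E P p q ev \<longleftrightarrow>
     is_product C E A P p q \<and> ev \<in> hom C P B \<and>
     (\<forall>X Q r s f. is_product C X A Q r s \<longrightarrow> f \<in> hom C Q B \<longrightarrow>
        (\<exists>!g. g \<in> hom C X E \<and>
          (\<exists>m. m \<in> hom C Q P \<and> p \<cdot>\<^bsub>C\<^esub> m = g \<cdot>\<^bsub>C\<^esub> r \<and> q \<cdot>\<^bsub>C\<^esub> m = s \<and> ev \<cdot>\<^bsub>C\<^esub> m = f)))"

definition cartesian_closed :: "('o, 'a) cat \<Rightarrow> bool" where
  "cartesian_closed C \<longleftrightarrow>
     (\<exists>T. is_terminal C T) \<and>
     (\<forall>A\<in>obj C. \<forall>B\<in>obj C. \<exists>P p q. is_product C A B P p q) \<and>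
     (\<forall>A\<in>obj C. \<forall>B\<in>obj C. \<exists>E P p q ev. is_exponential C A B E P p q ev)"

text \<open>The slice over \<open>X\<close>: objects are the arrows with target \<open>X\<close>, and \<open>(f, h, g)\<close> is the arrow
  \<open>h\<close> from \<open>f\<close> to \<open>g\<close>.\<close>

definition slice :: "('o, 'a) cat \<Rightarrow> 'o \<Rightarrow> ('a, 'a \<times> 'a \<times> 'a) cat" where
  "slice C X =
     \<lparr>obj = {f \<in> arr C. tgt C f = X},
      arr = {(f, h, g). f \<in> arr C \<and> tgt C f = X \<and> g \<in> arr C \<and> tgt C g = X \<and>
                        h \<in> hom C (src C f) (src C g) \<and> g \<cdot>\<^bsub>C\<^esub> h = f},
      src = (\<lambda>(f, h, g). f),
      tgt = (\<lambda>(f, h, g). g),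
      idn = (\<lambda>f. (f, idn C (src C f), f)),
      cmp = (\<lambda>(f', h', g') (f, h, g). (f, h' \<cdot>\<^bsub>C\<^esub> h, g'))\<rparr>"

definition locally_cartesian_closed :: "('o, 'a) cat \<Rightarrow> bool" where
  "locally_cartesian_closed C \<longleftrightarrow> (\<forall>X\<in>obj C. cartesian_closed (slice C X))"


section \<open>Locally presentable categories\<close>

text \<open>The distinction between sets and proper classes is expressed by a cardinal \<open>\<kappa>\<close>: a set is
  small if its cardinality is less than \<open>\<kappa>\<close>. For \<open>\<kappa>\<close> strongly inaccessible this is smallness
  relative to a Grothendieck universe, and the notions below are the usual ones; that \<open>\<kappa>\<close> be
  uncountable and a strong limit is not needed and not imposed.
  Up to isomorphism every small category has its objects and arrows in the type \<open>'u\<close> carrying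
  \<open>\<kappa>\<close>, and every cardinal below \<open>\<kappa>\<close> is represented on \<open>'u\<close>, so that quantification over
  small categories, small posets and small cardinals can be restricted to that type.\<close>

definition smallness_cardinal :: "'u rel \<Rightarrow> bool" where
  "smallness_cardinal \<kappa> \<longleftrightarrow> Card_order \<kappa> \<and> infinite (Field \<kappa>) \<and> regularCard \<kappa>"

definition small :: "'u rel \<Rightarrow> 'x set \<Rightarrow> bool" where
  "small \<kappa> A \<longleftrightarrow> |A| <o \<kappa>"

definition locally_small :: "'u rel \<Rightarrow> ('o, 'a) cat \<Rightarrow> bool" where
  "locally_small \<kappa> C \<longleftrightarrow> (\<forall>X\<in>obj C. \<forall>Y\<in>obj C. small \<kappa> (hom C X Y))"

definition cocomplete :: "'u rel \<Rightarrow> ('o, 'a) cat \<Rightarrow> bool" where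
  "cocomplete \<kappa> C \<longleftrightarrow>
     (\<forall>(J :: ('u, 'u) cat) F. category J \<longrightarrow> small \<kappa> (arr J) \<longrightarrow> is_functor J C F \<longrightarrow>
        (\<exists>X \<iota>. is_colimit J C F X \<iota>))"

definition poset_cat :: "'i set \<Rightarrow> 'i rel \<Rightarrow> ('i, 'i \<times> 'i) cat" where
  "poset_cat D R =
     \<lparr>obj = D, arr = {(x, y). x \<in> D \<and> y \<in> D \<and> (x, y) \<in> R}, src = fst, tgt = snd,
      idn = (\<lambda>x. (x, x)), cmp = (\<lambda>v u. (fst u, snd v))\<rparr>"

definition directed_poset :: "'l rel \<Rightarrow> 'i set \<Rightarrow> 'i rel \<Rightarrow> bool" where
  "directed_poset l D R \<longleftrightarrow>
     partial_order_on D R \<and> (\<forall>S\<subseteq>D. |S| <o l \<longrightarrow> (\<exists>u\<in>D. \<forall>s\<in>S. (s, u) \<in> R))"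

text \<open>\<open>hom C K\<close> preserves small \<open>l\<close>-directed colimits. The two conjuncts spell out that the canonical
  map from the directed colimit of the sets \<open>hom C K (fob F d)\<close> to \<open>hom C K X\<close> is surjective and
  injective; for the latter, two elements of a directed diagram of sets can be moved to a
  common stage first.\<close>

definition presentable :: "'u rel \<Rightarrow> 'u rel \<Rightarrow> ('o, 'a) cat \<Rightarrow> 'o \<Rightarrow> bool" where
  "presentable \<kappa> l C K \<longleftrightarrow>
     K \<in> obj C \<and>
     (\<forall>(D :: 'u set) R F X \<iota>.
        small \<kappa> D \<longrightarrow> directed_poset l D R \<longrightarrow> is_colimit (poset_cat D R) C F X \<iota> \<longrightarrow>
        (\<forall>f\<in>hom C K X. \<exists>d\<in>D. \<exists>u\<in>hom C K (fob F d). \<iota> d \<cdot>\<^bsub>C\<^esub> u = f) \<and>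
        (\<forall>d\<in>D. \<forall>u\<in>hom C K (fob F d). \<forall>v\<in>hom C K (fob F d). \<iota> d \<cdot>\<^bsub>C\<^esub> u = \<iota> d \<cdot>\<^bsub>C\<^esub> v \<longrightarrow>
           (\<exists>e\<in>D. (d, e) \<in> R \<and> far F (d, e) \<cdot>\<^bsub>C\<^esub> u = far F (d, e) \<cdot>\<^bsub>C\<^esub> v)))"

definition locally_presentable :: "'u rel \<Rightarrow> ('o, 'a) cat \<Rightarrow> bool" where
  "locally_presentable \<kappa> C \<longleftrightarrow>
     category C \<and> locally_small \<kappa> C \<and> cocomplete \<kappa> C \<and>
     (\<exists>(l :: 'u rel) S.
        Card_order l \<and> infinite (Field l) \<and> regularCard l \<and> l <o \<kappa> \<and>
        small \<kappa> S \<and> (\<forall>K\<in>S. presentable \<kappa> l C K) \<and>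
        (\<forall>X\<in>obj C. \<exists>(D :: 'u set) R F \<iota>.
           small \<kappa> D \<and> directed_poset l D R \<and> (\<forall>d\<in>D. fob F d \<in> S) \<and>
           is_colimit (poset_cat D R) C F X \<iota>))"


section \<open>Weak factorization systems\<close>

definition lifts_against :: "('o, 'a) cat \<Rightarrow> 'a \<Rightarrow> 'a \<Rightarrow> bool" where
  "lifts_against C i p \<longleftrightarrow>
     (\<forall>u v. u \<in> hom C (src C i) (src C p) \<longrightarrow> v \<in> hom C (tgt C i) (tgt C p) \<longrightarrow>
        p \<cdot>\<^bsub>C\<^esub> u = v \<cdot>\<^bsub>C\<^esub> i \<longrightarrow>
        (\<exists>h. h \<in> hom C (tgt C i) (src C p) \<and> h \<cdot>\<^bsub>C\<^esub> i = u \<and> p \<cdot>\<^bsub>C\<^esub> h = v))"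

definition rlp :: "('o, 'a) cat \<Rightarrow> 'a set \<Rightarrow> 'a set" where
  "rlp C L = {p \<in> arr C. \<forall>i\<in>L. lifts_against C i p}"

definition llp :: "('o, 'a) cat \<Rightarrow> 'a set \<Rightarrow> 'a set" where
  "llp C R = {i \<in> arr C. \<forall>p\<in>R. lifts_against C i p}"

definition wfs :: "('o, 'a) cat \<Rightarrow> 'a set \<Rightarrow> 'a set \<Rightarrow> bool" where
  "wfs C L R \<longleftrightarrow>
     L = llp C R \<and> R = rlp C L \<and>
     (\<forall>f\<in>arr C. \<exists>i p. i \<in> L \<and> p \<in> R \<and> src C i = src C f \<and> tgt C i = src C p \<and>
        tgt C p = tgt C f \<and> p \<cdot>\<^bsub>C\<^esub> i = f)"

definition cofibrantly_generated_by :: "'u rel \<Rightarrow> ('o, 'a) cat \<Rightarrow> 'a set \<Rightarrow> 'a set \<Rightarrow> 'a set \<Rightarrow> bool" where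
  "cofibrantly_generated_by \<kappa> C L R G \<longleftrightarrow>
     wfs C L R \<and> G \<subseteq> arr C \<and> small \<kappa> G \<and> R = rlp C G"

definition frobenius :: "('o, 'a) cat \<Rightarrow> 'a set \<Rightarrow> 'a set \<Rightarrow> bool" where
  "frobenius C L R \<longleftrightarrow>
     (\<forall>i p P u v. i \<in> L \<longrightarrow> p \<in> R \<longrightarrow> is_pullback C i p P u v \<longrightarrow> v \<in> L)"


section \<open>Functorial cylinders\<close>

text \<open>The endpoint inclusions and connections are indexed by \<open>k \<in> {0, 1}\<close>; on this set \<open>1 - k\<close> is
  the other endpoint.\<close>

definition functorial_cylinder ::
    "('o, 'a) cat \<Rightarrow> ('o, 'a, 'o, 'a) cfunctor \<Rightarrow> (nat \<Rightarrow> 'o \<Rightarrow> 'a) \<Rightarrow> bool" where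
  "functorial_cylinder C I \<delta> \<longleftrightarrow>
     is_functor C C I \<and> (\<forall>k\<in>{0, 1}. nat_trans C C id_functor I (\<delta> k))"

definition contraction ::
    "('o, 'a) cat \<Rightarrow> ('o, 'a, 'o, 'a) cfunctor \<Rightarrow> (nat \<Rightarrow> 'o \<Rightarrow> 'a) \<Rightarrow> ('o \<Rightarrow> 'a) \<Rightarrow> bool" where
  "contraction C I \<delta> \<epsilon> \<longleftrightarrow>
     nat_trans C C I id_functor \<epsilon> \<and>
     (\<forall>k\<in>{0, 1}. \<forall>X\<in>obj C. \<epsilon> X \<cdot>\<^bsub>C\<^esub> \<delta> k X = idn C X)"

definition connections :: "('o, 'a) cat \<Rightarrow> ('o, 'a, 'o, 'a) cfunctor \<Rightarrow> (nat \<Rightarrow> 'o \<Rightarrow> 'a) \<Rightarrow>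
    ('o \<Rightarrow> 'a) \<Rightarrow> (nat \<Rightarrow> 'o \<Rightarrow> 'a) \<Rightarrow> bool" where
  "connections C I \<delta> \<epsilon> c \<longleftrightarrow>
     (\<forall>k\<in>{0, 1}.
        nat_trans C C (comp_functor I I) I (c k) \<and>
        (\<forall>X\<in>obj C.
           c k X \<cdot>\<^bsub>C\<^esub> \<delta> k (fob I X) = \<delta> k X \<cdot>\<^bsub>C\<^esub> \<epsilon> X \<and>
           c k X \<cdot>\<^bsub>C\<^esub> far I (\<delta> k X) = \<delta> k X \<cdot>\<^bsub>C\<^esub> \<epsilon> X \<and>
           c k X \<cdot>\<^bsub>C\<^esub> \<delta> (1 - k) (fob I X) = idn C (fob I X) \<and>
           c k X \<cdot>\<^bsub>C\<^esub> far I (\<delta> (1 - k) X) = idn C (fob I X)))"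

text \<open>\<open>h\<close> is the Leibniz product of \<open>\<delta> k\<close> with \<open>i\<close>, formed with some choice \<open>P\<close> of the pushout; it is
  determined by \<open>k\<close> and \<open>i\<close> up to isomorphism. All choices are admitted.\<close>

definition is_leibniz_product :: "('o, 'a) cat \<Rightarrow> ('o, 'a, 'o, 'a) cfunctor \<Rightarrow>
    (nat \<Rightarrow> 'o \<Rightarrow> 'a) \<Rightarrow> nat \<Rightarrow> 'a \<Rightarrow> 'a \<Rightarrow> bool" where
  "is_leibniz_product C I \<delta> k i h \<longleftrightarrow>
     (\<exists>P p q. is_pushout C (\<delta> k (src C i)) i P p q \<and>
        h \<in> hom C P (fob I (tgt C i)) \<and>
        h \<cdot>\<^bsub>C\<^esub> p = far I i \<and> h \<cdot>\<^bsub>C\<^esub> q = \<delta> k (tgt C i))"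

definition leibniz_products :: "('o, 'a) cat \<Rightarrow> ('o, 'a, 'o, 'a) cfunctor \<Rightarrow>
    (nat \<Rightarrow> 'o \<Rightarrow> 'a) \<Rightarrow> 'a set \<Rightarrow> 'a set" where
  "leibniz_products C I \<delta> G = {h. \<exists>k\<in>{0, 1}. \<exists>i\<in>G. is_leibniz_product C I \<delta> k i h}"

definition suitable :: "'u rel \<Rightarrow> ('o, 'a) cat \<Rightarrow> ('o, 'a, 'o, 'a) cfunctor \<Rightarrow>
    (nat \<Rightarrow> 'o \<Rightarrow> 'a) \<Rightarrow> 'a set \<Rightarrow> 'a set \<Rightarrow> bool" where
  "suitable \<kappa> C I \<delta> Cof TrivFib \<longleftrightarrow>
     wfs C Cof TrivFib \<and>
     (\<exists>G. cofibrantly_generated_by \<kappa> C Cof TrivFib G) \<and>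
     (\<forall>Z X f. is_initial C Z \<longrightarrow> f \<in> hom C Z X \<longrightarrow> f \<in> Cof) \<and>
     (\<forall>i f P u v. i \<in> Cof \<longrightarrow> is_pullback C i f P u v \<longrightarrow> v \<in> Cof) \<and>
     (\<forall>k\<in>{0, 1}. \<forall>i\<in>Cof. \<forall>h. is_leibniz_product C I \<delta> k i h \<longrightarrow> h \<in> Cof)"

end

theory Submission
  imports Defs
begin

text \<open>
  The generators of the trivial cofibrations are the Leibniz products of the endpoint inclusions with
  the generating cofibrations, and everything is reduced to them.

  Pullback along a map \<open>p\<close> has a right adjoint, the dependent product along \<open>p\<close>, which in a locally
  cartesian closed category is built from exponentials in slices. By adjunction, pullback along fibrations
  preserves trivial cofibrations if dependent product along fibrations preserves fibrations, and by
  adjunction again this holds if every pullback of a generator along a fibration is a trivial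
  cofibration (\<open>frobenius_if_generators\<close>).

  For a generator this is shown with strong homotopy equivalences: maps \<open>f\<close> with an inverse \<open>g\<close> and
  homotopies \<open>g f \<sim> 1\<close> and \<open>f g \<sim> 1\<close> that \<open>f\<close> carries to one another. Generators are such maps, by the
  connections (\<open>she_leibniz_product\<close>). Pulling such a map back along a fibration yields another one
  (\<open>she_pullback\<close>): the homotopy on the codomain lifts because fibrations lift against the endpoint
  inclusions \<open>X \<rightarrow> I X\<close>, which are the Leibniz products with the cofibrations \<open>0 \<rightarrow> X\<close>, and the rest of the
  structure is determined by the lift. Cofibrations are stable under pullback too, and a cofibration that
  is a strong homotopy equivalence lifts against every fibration (\<open>she_lifts_against\<close>): its homotopies
  turn a lifting problem into an open box. Such boxes have fillings since, by the right adjoint of \<open>I\<close>,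
  the maps against which a fibration fills boxes are determined by a lifting condition, and hence
  include all cofibrations once they include the generating ones
  (\<open>fills_boxes_extends_to_cofibrations\<close>).
\<close>

section \<open>Calculating in a category\<close>

locale cat =
  fixes C :: "('o, 'a) cat" (structure)
  assumes category: "category C"
begin

lemma in_hom_iff [simp]: "f \<in> hom C X Y \<longleftrightarrow> f \<in> arr C \<and> src C f = X \<and> tgt C f = Y"
  by (auto simp: hom_def)

lemma src_obj [simp]: "f \<in> arr C \<Longrightarrow> src C f \<in> obj C"
  and tgt_obj [simp]: "f \<in> arr C \<Longrightarrow> tgt C f \<in> obj C"
  using category unfolding category_def by blast+

lemma idn_arr [simp]: "X \<in> obj C \<Longrightarrow> idn C X \<in> arr C"
  and src_idn [simp]: "X \<in> obj C \<Longrightarrow> src C (idn C X) = X"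
  and tgt_idn [simp]: "X \<in> obj C \<Longrightarrow> tgt C (idn C X) = X"
  using category unfolding category_def by auto

lemma comp_hom: "f \<in> hom C X Y \<Longrightarrow> g \<in> hom C Y Z \<Longrightarrow> g \<cdot> f \<in> hom C X Z"
  using category unfolding category_def by blast

lemma comp_arr [simp]: "f \<in> arr C \<Longrightarrow> g \<in> arr C \<Longrightarrow> tgt C f = src C g \<Longrightarrow> g \<cdot> f \<in> arr C"
  and src_comp [simp]: "f \<in> arr C \<Longrightarrow> g \<in> arr C \<Longrightarrow> tgt C f = src C g \<Longrightarrow> src C (g \<cdot> f) = src C f"
  and tgt_comp [simp]: "f \<in> arr C \<Longrightarrow> g \<in> arr C \<Longrightarrow> tgt C f = src C g \<Longrightarrow> tgt C (g \<cdot> f) = tgt C g"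
  using comp_hom[of f "src C f" "tgt C f" g "tgt C g"] by auto

lemma comp_idn [simp]: "f \<in> arr C \<Longrightarrow> X = src C f \<Longrightarrow> f \<cdot> idn C X = f"
  and idn_comp [simp]: "f \<in> arr C \<Longrightarrow> Y = tgt C f \<Longrightarrow> idn C Y \<cdot> f = f"
  using category unfolding category_def hom_def by blast+

lemma comp_assoc [simp]:
  "f \<in> arr C \<Longrightarrow> g \<in> arr C \<Longrightarrow> h \<in> arr C \<Longrightarrow> tgt C f = src C g \<Longrightarrow> tgt C g = src C h \<Longrightarrow>
   (h \<cdot> g) \<cdot> f = h \<cdot> (g \<cdot> f)"
  using category unfolding category_def hom_def by blast

text \<open>Composites are kept in right-associated normal form; this variant makes an equation
  between composites applicable inside such a normal form.\<close>

lemma comp_left: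
  "g \<cdot> f = e \<Longrightarrow> f \<in> arr C \<Longrightarrow> g \<in> arr C \<Longrightarrow> x \<in> arr C \<Longrightarrow> tgt C x = src C f \<Longrightarrow>
   tgt C f = src C g \<Longrightarrow> g \<cdot> (f \<cdot> x) = e \<cdot> x"
  using comp_assoc[of x f g] by simp

lemma pullbackD:
  assumes "is_pullback C f g P p q"
  shows "f \<in> arr C" "g \<in> arr C" "tgt C f = tgt C g" "p \<in> arr C" "src C p = P" "tgt C p = src C f"
    "q \<in> arr C" "src C q = P" "tgt C q = src C g" "f \<cdot> p = g \<cdot> q"
  using assms unfolding is_pullback_def by auto

lemma pullback_ex1:
  assumes "is_pullback C f g P p q" "u \<in> hom C X (src C f)" "v \<in> hom C X (src C g)" "f \<cdot> u = g \<cdot> v"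
  shows "\<exists>!h. h \<in> hom C X P \<and> p \<cdot> h = u \<and> q \<cdot> h = v"
  using assms unfolding is_pullback_def by blast

lemma pullback_lift:
  assumes "is_pullback C f g P p q" "u \<in> hom C X (src C f)" "v \<in> hom C X (src C g)" "f \<cdot> u = g \<cdot> v"
  obtains h where "h \<in> arr C" "src C h = X" "tgt C h = P" "p \<cdot> h = u" "q \<cdot> h = v"
  using pullback_ex1[OF assms] by auto

lemma pullback_eqI:
  assumes P: "is_pullback C f g P p q"
    and h: "h \<in> arr C" "h' \<in> arr C" "src C h = src C h'" "tgt C h = P" "tgt C h' = P"
    and eq: "p \<cdot> h = p \<cdot> h'" "q \<cdot> h = q \<cdot> h'"
  shows "h = h'"
proof -
  note [simp] = pullbackD(1-9)[OF P] h
  have "f \<cdot> (p \<cdot> h') = g \<cdot> (q \<cdot> h')"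
    using comp_left[OF pullbackD(10)[OF P], of h'] by simp
  then have "\<exists>!k. k \<in> hom C (src C h') P \<and> p \<cdot> k = p \<cdot> h' \<and> q \<cdot> k = q \<cdot> h'"
    by (intro pullback_ex1[OF P]) auto
  then show ?thesis using eq h in_hom_iff by metis
qed

lemma pushoutD:
  assumes "is_pushout C f g P p q"
  shows "f \<in> arr C" "g \<in> arr C" "src C f = src C g" "p \<in> arr C" "tgt C p = P" "src C p = tgt C f"
    "q \<in> arr C" "tgt C q = P" "src C q = tgt C g" "p \<cdot> f = q \<cdot> g"
  using assms unfolding is_pushout_def by auto

lemma pushout_ex1:
  assumes "is_pushout C f g P p q" "u \<in> hom C (tgt C f) X" "v \<in> hom C (tgt C g) X" "u \<cdot> f = v \<cdot> g"
  shows "\<exists>!h. h \<in> hom C P X \<and> h \<cdot> p = u \<and> h \<cdot> q = v"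
  using assms unfolding is_pushout_def by blast

lemma pushout_desc:
  assumes "is_pushout C f g P p q" "u \<in> hom C (tgt C f) X" "v \<in> hom C (tgt C g) X" "u \<cdot> f = v \<cdot> g"
  obtains h where "h \<in> arr C" "src C h = P" "tgt C h = X" "h \<cdot> p = u" "h \<cdot> q = v"
  using pushout_ex1[OF assms] by auto

lemma pushout_eqI:
  assumes P: "is_pushout C f g P p q"
    and h: "h \<in> arr C" "h' \<in> arr C" "src C h = P" "src C h' = P" "tgt C h = tgt C h'"
    and eq: "h \<cdot> p = h' \<cdot> p" "h \<cdot> q = h' \<cdot> q"
  shows "h = h'"
proof -
  note [simp] = pushoutD(1-9)[OF P] h
  have "(h' \<cdot> p) \<cdot> f = (h' \<cdot> q) \<cdot> g"
    using pushoutD(10)[OF P] by simp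
  then have "\<exists>!k. k \<in> hom C P (tgt C h') \<and> k \<cdot> p = h' \<cdot> p \<and> k \<cdot> q = h' \<cdot> q"
    by (intro pushout_ex1[OF P]) auto
  then show ?thesis using eq h in_hom_iff by metis
qed

lemma pullback_of_idn:
  assumes [simp]: "p \<in> arr C"
  shows "is_pullback C (idn C (tgt C p)) p (src C p) p (idn C (src C p))"
  unfolding is_pullback_def
proof (intro conjI allI impI)
  fix X u v assume u: "u \<in> hom C X (src C (idn C (tgt C p)))" and v: "v \<in> hom C X (src C p)"
    and eq: "idn C (tgt C p) \<cdot> u = p \<cdot> v"
  have "p \<cdot> v = u" using u eq by simp
  with v show "\<exists>!h. h \<in> hom C X (src C p) \<and> p \<cdot> h = u \<and> idn C (src C p) \<cdot> h = v"
    by (intro ex1I[of _ v]) (simp, elim conjE, simp)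
qed simp_all

lemma pullback_paste:
  assumes P: "is_pullback C y p M s w" and Q: "is_pullback C j s M' s' j'"
  shows "is_pullback C (y \<cdot> j) p M' s' (w \<cdot> j')"
proof -
  note [simp] = pullbackD(1-9)[OF P] pullbackD(1-9)[OF Q]
  note P10 = pullbackD(10)[OF P] note Q10 = pullbackD(10)[OF Q]
  note [simp] = P10[symmetric] Q10[symmetric] comp_left[OF P10[symmetric]] comp_left[OF Q10[symmetric]]
  have "tgt C j = src C y" using pullbackD(3)[OF Q] by simp
  note [simp] = this
  show ?thesis
    unfolding is_pullback_def
  proof (intro conjI allI impI)
    fix X u v
    assume u: "u \<in> hom C X (src C (y \<cdot> j))" and v: "v \<in> hom C X (src C p)"
      and eq: "(y \<cdot> j) \<cdot> u = p \<cdot> v"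
    note [simp] = u[simplified] v[simplified]
    obtain h where h: "h \<in> arr C" "src C h = X" "tgt C h = M" "s \<cdot> h = j \<cdot> u" "w \<cdot> h = v"
      using pullback_lift[OF P, of "j \<cdot> u" X v] eq by auto
    obtain k where k: "k \<in> arr C" "src C k = X" "tgt C k = M'" "s' \<cdot> k = u" "j' \<cdot> k = h"
      using pullback_lift[OF Q, of u X h] h by auto
    show "\<exists>!h. h \<in> hom C X M' \<and> s' \<cdot> h = u \<and> (w \<cdot> j') \<cdot> h = v"
    proof (intro ex1I[of _ k])
      show "k \<in> hom C X M' \<and> s' \<cdot> k = u \<and> (w \<cdot> j') \<cdot> k = v" using h k by simp
      fix l assume l: "l \<in> hom C X M' \<and> s' \<cdot> l = u \<and> (w \<cdot> j') \<cdot> l = v"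
      then have l': "l \<in> arr C" "src C l = X" "tgt C l = M'" "s' \<cdot> l = u" "w \<cdot> (j' \<cdot> l) = v" by auto
      note [simp] = l'(1-3) h(1-3) k(1-3)
      have "s \<cdot> (j' \<cdot> l) = j \<cdot> (s' \<cdot> l)" by simp
      then have "j' \<cdot> l = h"
        using pullback_eqI[OF P, of "j' \<cdot> l" h] h l'(4,5) by simp
      then show "l = k" using pullback_eqI[OF Q, of l k] l' k by simp
    qed
  qed auto
qed

end

section \<open>Dependent products in locally cartesian closed categories\<close>

lemma slice_simps [simp]:
  "obj (slice C X) = {f \<in> arr C. tgt C f = X}"
  "src (slice C X) (f, h, g) = f" "tgt (slice C X) (f, h, g) = g"
  "cmp (slice C X) (f', h', g') (f, h, g) = (f, cmp C h' h, g')"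
  by (simp_all add: slice_def)

lemma in_hom_slice:
  "x \<in> hom (slice C X) f g \<longleftrightarrow>
     (\<exists>h. x = (f, h, g) \<and> f \<in> arr C \<and> tgt C f = X \<and> g \<in> arr C \<and> tgt C g = X \<and>
          h \<in> hom C (src C f) (src C g) \<and> cmp C g h = f)"
  by (auto simp: hom_def slice_def)

context cat
begin

lemma pullback_is_slice_product:
  assumes P: "is_pullback C a b Q p q" and X: "tgt C a = X"
  shows "is_product (slice C X) a b (a \<cdot> p) (a \<cdot> p, p, a) (a \<cdot> p, q, b)"
proof -
  note [simp] = pullbackD(1-9)[OF P] X[symmetric]
  have eq: "b \<cdot> q = a \<cdot> p" using pullbackD(10)[OF P] by simp
  note [simp] = eq comp_left[OF eq]
  show ?thesis
    unfolding is_product_def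
  proof (intro conjI allI impI)
    fix w f g
    assume "f \<in> hom (slice C X) w a" "g \<in> hom (slice C X) w b"
    then obtain u v where uv: "f = (w, u, a)" "g = (w, v, b)" "u \<in> hom C (src C w) (src C a)"
        "v \<in> hom C (src C w) (src C b)" "a \<cdot> u = w" "b \<cdot> v = w" "w \<in> arr C"
      by (auto simp: in_hom_slice)
    obtain h where h: "h \<in> arr C" "src C h = src C w" "tgt C h = Q" "p \<cdot> h = u" "q \<cdot> h = v"
      using pullback_lift[OF P, of u "src C w" v] uv by auto
    show "\<exists>!h. h \<in> hom (slice C X) w (a \<cdot> p) \<and> cmp (slice C X) (a \<cdot> p, p, a) h = f \<and>
            cmp (slice C X) (a \<cdot> p, q, b) h = g"
    proof (intro ex1I[of _ "(w, h, a \<cdot> p)"])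
      have w: "src C u = src C w" "src C v = src C w" "tgt C w = tgt C a"
        using uv by auto
      show "(w, h, a \<cdot> p) \<in> hom (slice C X) w (a \<cdot> p) \<and>
          cmp (slice C X) (a \<cdot> p, p, a) (w, h, a \<cdot> p) = f \<and>
          cmp (slice C X) (a \<cdot> p, q, b) (w, h, a \<cdot> p) = g"
        using h uv(1,2,5-7) w by (simp add: in_hom_slice)
      fix k assume k: "k \<in> hom (slice C X) w (a \<cdot> p) \<and> cmp (slice C X) (a \<cdot> p, p, a) k = f \<and>
            cmp (slice C X) (a \<cdot> p, q, b) k = g"
      then obtain l where l: "k = (w, l, a \<cdot> p)" "l \<in> arr C" "src C l = src C w" "tgt C l = Q"
        unfolding in_hom_slice by auto
      with k uv(1,2) have "p \<cdot> l = u" "q \<cdot> l = v" by simp_all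
      with l h have "l = h" using pullback_eqI[OF P, of l h] by simp
      with l show "k = (w, h, a \<cdot> p)" by simp
    qed
  qed (auto simp: in_hom_slice)
qed

lemma slice_product_is_pullback:
  assumes P: "is_product (slice C X) a b w pp qq"
  obtains p q where "pp = (w, p, a)" "qq = (w, q, b)" "is_pullback C a b (src C w) p q" "a \<cdot> p = w"
proof -
  obtain p q where pq: "pp = (w, p, a)" "qq = (w, q, b)" "p \<in> hom C (src C w) (src C a)"
      "q \<in> hom C (src C w) (src C b)" "a \<cdot> p = w" "b \<cdot> q = w" "w \<in> arr C" "tgt C w = X"
      "a \<in> arr C" "b \<in> arr C" "tgt C a = X" "tgt C b = X"
    using P unfolding is_product_def in_hom_slice by blast
  note [simp] = pq(3,4)[simplified] pq(5-12) comp_left[OF pq(5)] comp_left[OF pq(6)]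
  have "is_pullback C a b (src C w) p q"
    unfolding is_pullback_def
  proof (intro conjI allI impI)
    fix Y u v assume u: "u \<in> hom C Y (src C a)" and v: "v \<in> hom C Y (src C b)" and eq: "a \<cdot> u = b \<cdot> v"
    note [simp] = u[simplified] v[simplified]
    have "(a \<cdot> u, u, a) \<in> hom (slice C X) (a \<cdot> u) a" "(a \<cdot> u, v, b) \<in> hom (slice C X) (a \<cdot> u) b"
      using eq by (auto simp: in_hom_slice)
    then have ex: "\<exists>!h. h \<in> hom (slice C X) (a \<cdot> u) w \<and> cmp (slice C X) pp h = (a \<cdot> u, u, a) \<and>
        cmp (slice C X) qq h = (a \<cdot> u, v, b)"
      using P unfolding is_product_def by blast
    then obtain k where k: "k \<in> hom (slice C X) (a \<cdot> u) w" "cmp (slice C X) pp k = (a \<cdot> u, u, a)"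
        "cmp (slice C X) qq k = (a \<cdot> u, v, b)"
      by blast
    from k(1) obtain h where k_h: "k = (a \<cdot> u, h, w)" "h \<in> hom C (src C (a \<cdot> u)) (src C w)"
      unfolding in_hom_slice by blast
    with k(2,3) have h: "h \<in> hom C Y (src C w)" "p \<cdot> h = u" "q \<cdot> h = v"
      by (simp_all add: pq(1,2))
    show "\<exists>!h. h \<in> hom C Y (src C w) \<and> p \<cdot> h = u \<and> q \<cdot> h = v"
    proof (intro ex1I[of _ h])
      show "h \<in> hom C Y (src C w) \<and> p \<cdot> h = u \<and> q \<cdot> h = v" using h by blast
      fix k assume k: "k \<in> hom C Y (src C w) \<and> p \<cdot> k = u \<and> q \<cdot> k = v"
      have lift: "(a \<cdot> u, l, w) \<in> hom (slice C X) (a \<cdot> u) w \<and>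
          cmp (slice C X) pp (a \<cdot> u, l, w) = (a \<cdot> u, u, a) \<and>
          cmp (slice C X) qq (a \<cdot> u, l, w) = (a \<cdot> u, v, b)"
        if l: "l \<in> hom C Y (src C w) \<and> p \<cdot> l = u \<and> q \<cdot> l = v" for l
      proof -
        have "w \<cdot> l = a \<cdot> u"
          using l comp_left[OF pq(5), of l] by simp
        then show ?thesis using l by (simp add: in_hom_slice pq(1,2))
      qed
      from lift[of h] lift[of k] h k ex have "(a \<cdot> u, k, w) = (a \<cdot> u, h, w)"
        by blast
      then show "k = h" by simp
    qed
  qed auto
  with pq show thesis using that by blast
qed

end

locale lcc_cat = cat +
  assumes lcc: "locally_cartesian_closed C"
begin

lemma pullback_exists:
  assumes "f \<in> arr C" "g \<in> arr C" "tgt C f = tgt C g"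
  obtains P p q where "is_pullback C f g P p q"
proof -
  have "cartesian_closed (slice C (tgt C f))"
    using lcc assms unfolding locally_cartesian_closed_def by simp
  moreover have "f \<in> obj (slice C (tgt C f))" "g \<in> obj (slice C (tgt C f))"
    using assms by auto
  ultimately obtain w pp qq where "is_product (slice C (tgt C f)) f g w pp qq"
    unfolding cartesian_closed_def by meson
  then obtain p q where "is_pullback C f g (src C w) p q"
    by (rule slice_product_is_pullback)
  then show thesis by (rule that)
qed

text \<open>The exponential in the slice over \<open>B\<close>, expressed in the category itself: arrows of the slice are
  replaced by their underlying arrows and products by pullbacks.\<close>

lemma exponential_over:
  assumes p: "p \<in> arr C" "tgt C p = B" and z: "z \<in> arr C" "tgt C z = B"
  obtains e N s w ev where "is_pullback C e p N s w" "ev \<in> hom C N (src C z)" "z \<cdot> ev = p \<cdot> w"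
    "\<forall>t M s' w' f. is_pullback C t p M s' w' \<longrightarrow> f \<in> hom C M (src C z) \<longrightarrow> z \<cdot> f = p \<cdot> w' \<longrightarrow>
       (\<exists>!g. g \<in> hom C (src C t) (src C e) \<and> e \<cdot> g = t \<and>
         (\<exists>m. m \<in> hom C M N \<and> s \<cdot> m = g \<cdot> s' \<and> w \<cdot> m = w' \<and> ev \<cdot> m = f))"
proof -
  let ?S = "slice C B"
  have "cartesian_closed ?S"
    using lcc p unfolding locally_cartesian_closed_def by auto
  moreover have "p \<in> obj ?S" "z \<in> obj ?S" using p z by auto
  ultimately obtain e n ss ww vv where exp: "is_exponential ?S p z e n ss ww vv"
    unfolding cartesian_closed_def by meson
  then have "is_product ?S e p n ss ww" "vv \<in> hom ?S n z"
    unfolding is_exponential_def by blast+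
  obtain s w where sw: "ss = (n, s, e)" "ww = (n, w, p)" "is_pullback C e p (src C n) s w" "e \<cdot> s = n"
    using slice_product_is_pullback[OF \<open>is_product ?S e p n ss ww\<close>] by blast
  obtain ev where ev: "vv = (n, ev, z)" "ev \<in> hom C (src C n) (src C z)" "z \<cdot> ev = n"
      "n \<in> arr C" "tgt C n = B"
    using \<open>vv \<in> hom ?S n z\<close> unfolding in_hom_slice by blast
  note P [simp] = pullbackD(1-9)[OF sw(3)]
  note [simp] = ev(2)[simplified] ev(4,5) p z
  have eB [simp]: "tgt C e = B" by simp
  show thesis
  proof (rule that[OF sw(3) ev(2)], goal_cases)
    case 1
    show "z \<cdot> ev = p \<cdot> w" using ev(3) sw(4) pullbackD(10)[OF sw(3)] by simp
  next
    case 2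
    show ?case
    proof (intro allI impI)
      fix t M s' w' f
      assume T: "is_pullback C t p M s' w'" and f: "f \<in> hom C M (src C z)" and zf: "z \<cdot> f = p \<cdot> w'"
      note [simp] = pullbackD(1-9)[OF T] f[simplified]
      have ts: "t \<cdot> s' = p \<cdot> w'" by (rule pullbackD(10)[OF T])
      have fh: "(t \<cdot> s', f, z) \<in> hom ?S (t \<cdot> s') z"
        using zf ts by (simp add: in_hom_slice)
      have "\<exists>!g. g \<in> hom ?S t e \<and> (\<exists>m. m \<in> hom ?S (t \<cdot> s') n \<and>
          cmp ?S ss m = cmp ?S g (t \<cdot> s', s', t) \<and> cmp ?S ww m = (t \<cdot> s', w', p) \<and>
          cmp ?S vv m = (t \<cdot> s', f, z))"
        using exp fh pullback_is_slice_product[OF T, of B] unfolding is_exponential_def by simp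
      moreover have "(t, g, e) \<in> hom ?S t e \<and> (\<exists>m. m \<in> hom ?S (t \<cdot> s') n \<and>
          cmp ?S ss m = cmp ?S (t, g, e) (t \<cdot> s', s', t) \<and> cmp ?S ww m = (t \<cdot> s', w', p) \<and>
          cmp ?S vv m = (t \<cdot> s', f, z)) \<longleftrightarrow>
          g \<in> hom C (src C t) (src C e) \<and> e \<cdot> g = t \<and>
           (\<exists>m. m \<in> hom C M (src C n) \<and> s \<cdot> m = g \<cdot> s' \<and> w \<cdot> m = w' \<and> ev \<cdot> m = f)" (is "?L g \<longleftrightarrow> ?R g") for g
      proof
        assume L: "?L g"
        then have g: "g \<in> hom C (src C t) (src C e)" "e \<cdot> g = t"
          by (auto simp: in_hom_slice)
        from L obtain m where m: "m \<in> hom ?S (t \<cdot> s') n" "cmp ?S ss m = cmp ?S (t, g, e) (t \<cdot> s', s', t)"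
          "cmp ?S ww m = (t \<cdot> s', w', p)" "cmp ?S vv m = (t \<cdot> s', f, z)" by blast
        from m(1) obtain m' where "m = (t \<cdot> s', m', n)" "m' \<in> hom C (src C (t \<cdot> s')) (src C n)"
          unfolding in_hom_slice by blast
        then have "m' \<in> hom C M (src C n) \<and> s \<cdot> m' = g \<cdot> s' \<and> w \<cdot> m' = w' \<and> ev \<cdot> m' = f"
          using m(2-4) by (simp add: sw(1,2) ev(1))
        with g show "?R g" by blast
      next
        assume R: "?R g"
        then obtain m where g: "g \<in> arr C" "src C g = src C t" "tgt C g = src C e" "e \<cdot> g = t"
          and m: "m \<in> arr C" "src C m = M" "tgt C m = src C n" "s \<cdot> m = g \<cdot> s'" "w \<cdot> m = w'" "ev \<cdot> m = f"
          by auto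
        have "n \<cdot> m = t \<cdot> s'"
          using comp_left[OF sw(4), of m] comp_left[OF g(4), of s'] m g by simp
        then have "(t \<cdot> s', m, n) \<in> hom ?S (t \<cdot> s') n \<and>
          cmp ?S ss (t \<cdot> s', m, n) = cmp ?S (t, g, e) (t \<cdot> s', s', t) \<and>
          cmp ?S ww (t \<cdot> s', m, n) = (t \<cdot> s', w', p) \<and> cmp ?S vv (t \<cdot> s', m, n) = (t \<cdot> s', f, z)"
          using m by (simp add: in_hom_slice sw(1,2) ev(1))
        moreover have "(t, g, e) \<in> hom ?S t e"
          using g by (simp add: in_hom_slice)
        ultimately show "?L g" by blast
      qed
      moreover have "\<exists>h. g = (t, h, e)" if "g \<in> hom ?S t e" for g
        using that unfolding in_hom_slice by blast
      ultimately show "\<exists>!g. g \<in> hom C (src C t) (src C e) \<and> e \<cdot> g = t \<and>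
           (\<exists>m. m \<in> hom C M (src C n) \<and> s \<cdot> m = g \<cdot> s' \<and> w \<cdot> m = w' \<and> ev \<cdot> m = f)"
        by (smt (verit, ccfv_threshold) prod.inject)
    qed
  qed
qed

end

text \<open>An arrow \<open>r : R \<rightarrow> B\<close> represents the dependent product of \<open>q : Z \<rightarrow> Q\<close> along \<open>p : Q \<rightarrow> B\<close>:
  arrows over \<open>B\<close> from \<open>t\<close> to \<open>r\<close> correspond, by evaluation at \<open>ev\<close>, to sections of \<open>q\<close> over the
  pullback of \<open>t\<close> along \<open>p\<close>. The pullbacks are given by their universal property, so \<open>g \<times> Q\<close> appears as
  the arrow \<open>m\<close> that it induces.\<close>

definition is_dependent_product ::
    "('o, 'a) cat \<Rightarrow> 'a \<Rightarrow> 'a \<Rightarrow> 'a \<Rightarrow> 'o \<Rightarrow> 'a \<Rightarrow> 'a \<Rightarrow> 'a \<Rightarrow> bool" where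
  "is_dependent_product C p q r N s w ev \<longleftrightarrow>
     q \<in> arr C \<and> tgt C q = src C p \<and>
     is_pullback C r p N s w \<and> ev \<in> hom C N (src C q) \<and> cmp C q ev = w \<and>
     (\<forall>t M s' w' f. is_pullback C t p M s' w' \<longrightarrow> f \<in> hom C M (src C q) \<longrightarrow> cmp C q f = w' \<longrightarrow>
       (\<exists>!g. g \<in> hom C (src C t) (src C r) \<and> cmp C r g = t \<and>
         (\<exists>m. m \<in> hom C M N \<and> cmp C s m = cmp C g s' \<and> cmp C w m = w' \<and> cmp C ev m = f)))"

context lcc_cat
begin

text \<open>Over the base of \<open>p\<close>, an arrow from \<open>t\<close> to the exponential \<open>(p q)\<^sup>p\<close> is an arrow from the pullback of
  \<open>t\<close> along \<open>p\<close> to the domain of \<open>q\<close>. It is a section of \<open>q\<close> exactly if \<open>q\<^sup>p\<close> sends it to the constant name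
  of the identity of \<open>p\<close>. So the dependent product is the pullback of \<open>q\<^sup>p\<close> along that name.\<close>

lemma dependent_product_exists:
  assumes p: "p \<in> arr C" and q: "q \<in> arr C" "tgt C q = src C p"
  obtains r N s w ev where "is_dependent_product C p q r N s w ev"
proof -
  define B where "B = tgt C p"
  note [simp] = p q B_def[symmetric]
  have [simp]: "B \<in> obj C" using tgt_obj[OF p] by simp
  have pq: "p \<cdot> q \<in> arr C" "tgt C (p \<cdot> q) = B" by simp_all
  obtain e1 N1 s1 w1 ev1 where P1: "is_pullback C e1 p N1 s1 w1" and ev1: "ev1 \<in> hom C N1 (src C (p \<cdot> q))"
    and pqev1: "(p \<cdot> q) \<cdot> ev1 = p \<cdot> w1"
    and U1: "\<forall>t M s' w' f. is_pullback C t p M s' w' \<longrightarrow> f \<in> hom C M (src C (p \<cdot> q)) \<longrightarrow>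
       (p \<cdot> q) \<cdot> f = p \<cdot> w' \<longrightarrow> (\<exists>!g. g \<in> hom C (src C t) (src C e1) \<and> e1 \<cdot> g = t \<and>
         (\<exists>m. m \<in> hom C M N1 \<and> s1 \<cdot> m = g \<cdot> s' \<and> w1 \<cdot> m = w' \<and> ev1 \<cdot> m = f))"
    by (rule exponential_over[OF p B_def[symmetric] pq]) (rule that)
  obtain e2 N2 s2 w2 ev2 where P2: "is_pullback C e2 p N2 s2 w2" and ev2: "ev2 \<in> hom C N2 (src C p)"
    and U2: "\<forall>t M s' w' f. is_pullback C t p M s' w' \<longrightarrow> f \<in> hom C M (src C p) \<longrightarrow>
       p \<cdot> f = p \<cdot> w' \<longrightarrow> (\<exists>!g. g \<in> hom C (src C t) (src C e2) \<and> e2 \<cdot> g = t \<and>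
         (\<exists>m. m \<in> hom C M N2 \<and> s2 \<cdot> m = g \<cdot> s' \<and> w2 \<cdot> m = w' \<and> ev2 \<cdot> m = f))"
    by (rule exponential_over[OF p B_def[symmetric] p B_def[symmetric]]) (rule that)
  note [simp] = pullbackD(1-2,4-9)[OF P1] pullbackD(1-2,4-9)[OF P2]
  note [simp] = ev1[simplified] ev2[simplified]
  have [simp]: "tgt C e1 = B" "tgt C e2 = B"
    using pullbackD(3)[OF P1] pullbackD(3)[OF P2] by simp_all
  have e1s1: "e1 \<cdot> s1 = p \<cdot> w1" by (rule pullbackD(10)[OF P1])
  have pq_ev1: "p \<cdot> (q \<cdot> ev1) = p \<cdot> w1" using pqev1 by simp
  have q_ev1: "q \<cdot> ev1 \<in> hom C N1 (src C p)" and idQ: "idn C (src C p) \<in> hom C (src C p) (src C p)"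
    by simp_all
  \<comment> \<open>\<open>m\<close> is \<open>q\<^sup>p\<close>, and \<open>n\<close> is the name of the identity of \<open>p\<close>.\<close>
  obtain m m2 where m: "m \<in> hom C (src C e1) (src C e2)" "e2 \<cdot> m = e1"
    and m2: "m2 \<in> hom C N1 N2" "s2 \<cdot> m2 = m \<cdot> s1" "w2 \<cdot> m2 = w1" "ev2 \<cdot> m2 = q \<cdot> ev1"
    using U2[rule_format, OF P1 q_ev1 pq_ev1] by (elim ex1E exE conjE) (rule that)
  have PB: "is_pullback C (idn C B) p (src C p) p (idn C (src C p))"
    using pullback_of_idn[of p] by simp
  obtain n m3 where n: "n \<in> hom C (src C (idn C B)) (src C e2)" "e2 \<cdot> n = idn C B"
    and m3: "m3 \<in> hom C (src C p) N2" "s2 \<cdot> m3 = n \<cdot> p"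
      "w2 \<cdot> m3 = idn C (src C p)" "ev2 \<cdot> m3 = idn C (src C p)"
    using U2[rule_format, OF PB idQ refl] by (elim ex1E exE conjE) (rule that)
  note [simp] = m(1)[simplified] m2(1)[simplified] n(1)[simplified] m3(1)[simplified]
  obtain R a r where PR: "is_pullback C m n R a r"
    using pullback_exists[of m n] by auto
  note [simp] = pullbackD(1-2,4-9)[OF PR]
  have man: "m \<cdot> a = n \<cdot> r" by (rule pullbackD(10)[OF PR])
  have e1a: "e1 \<cdot> a = r"
    using comp_left[OF m(2), of a] comp_left[OF n(2), of r] man by simp
  obtain N s w where PN: "is_pullback C r p N s w"
    using pullback_exists[of r p] by auto
  note [simp] = pullbackD(1-2,4-9)[OF PN]
  have rs: "r \<cdot> s = p \<cdot> w" by (rule pullbackD(10)[OF PN])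
  obtain mm where mm: "mm \<in> arr C" "src C mm = N" "tgt C mm = N1" "s1 \<cdot> mm = a \<cdot> s" "w1 \<cdot> mm = w"
    using pullback_lift[OF P1, of "a \<cdot> s" N w] comp_left[OF e1a, of s] rs by auto
  note [simp] = mm(1-3)
  have mm_eq: "m2 \<cdot> mm = m3 \<cdot> w"
  proof -
    have "s2 \<cdot> (m2 \<cdot> mm) = s2 \<cdot> (m3 \<cdot> w)"
      using comp_left[OF m2(2), of mm] comp_left[OF m3(2), of w] mm(4) comp_left[OF man, of s] rs by simp
    moreover have "w2 \<cdot> (m2 \<cdot> mm) = w2 \<cdot> (m3 \<cdot> w)"
      using comp_left[OF m2(3), of mm] comp_left[OF m3(3), of w] mm(5) by simp
    ultimately show ?thesis
      using pullback_eqI[OF P2, of "m2 \<cdot> mm" "m3 \<cdot> w"] by simp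
  qed
  have q_ev: "q \<cdot> (ev1 \<cdot> mm) = w"
    using comp_left[OF m2(4), of mm] comp_left[OF m3(4), of w] mm_eq by simp
  have "is_dependent_product C p q r N s w (ev1 \<cdot> mm)"
    unfolding is_dependent_product_def
  proof (intro conjI allI impI)
    fix t M s' w' f
    assume T: "is_pullback C t p M s' w'" and f: "f \<in> hom C M (src C q)" and qf: "q \<cdot> f = w'"
    note [simp] = pullbackD(1-2,4-9)[OF T] f[simplified]
    have [simp]: "tgt C t = B" using pullbackD(3)[OF T] by simp
    have ts: "t \<cdot> s' = p \<cdot> w'" by (rule pullbackD(10)[OF T])
    have ex1: "\<exists>!g. g \<in> hom C (src C t) (src C e1) \<and> e1 \<cdot> g = t \<and>
         (\<exists>m. m \<in> hom C M N1 \<and> s1 \<cdot> m = g \<cdot> s' \<and> w1 \<cdot> m = w' \<and> ev1 \<cdot> m = f)"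
      using U1[rule_format, OF T, of f] qf by simp
    obtain g1 m1 where g1: "g1 \<in> hom C (src C t) (src C e1)" "e1 \<cdot> g1 = t"
      and m1: "m1 \<in> hom C M N1" "s1 \<cdot> m1 = g1 \<cdot> s'" "w1 \<cdot> m1 = w'" "ev1 \<cdot> m1 = f"
      using ex1 by (elim ex1E exE conjE) (rule that)
    note [simp] = g1(1)[simplified] m1(1)[simplified]
    have mg: "m \<cdot> g1 = n \<cdot> t"
    proof -
      have ex2: "\<exists>!g. g \<in> hom C (src C t) (src C e2) \<and> e2 \<cdot> g = t \<and>
         (\<exists>m. m \<in> hom C M N2 \<and> s2 \<cdot> m = g \<cdot> s' \<and> w2 \<cdot> m = w' \<and> ev2 \<cdot> m = w')"
        using U2[rule_format, OF T, of w'] by simp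
      have "m2 \<cdot> m1 \<in> hom C M N2 \<and> s2 \<cdot> (m2 \<cdot> m1) = (m \<cdot> g1) \<cdot> s' \<and> w2 \<cdot> (m2 \<cdot> m1) = w' \<and>
          ev2 \<cdot> (m2 \<cdot> m1) = w'"
        using comp_left[OF m2(2), of m1] comp_left[OF m2(3), of m1] comp_left[OF m2(4), of m1] m1(2-4) qf
        by simp
      moreover have "m \<cdot> g1 \<in> hom C (src C t) (src C e2) \<and> e2 \<cdot> (m \<cdot> g1) = t"
        using comp_left[OF m(2), of g1] g1(2) by simp
      moreover have "m3 \<cdot> w' \<in> hom C M N2 \<and> s2 \<cdot> (m3 \<cdot> w') = (n \<cdot> t) \<cdot> s' \<and> w2 \<cdot> (m3 \<cdot> w') = w' \<and>
          ev2 \<cdot> (m3 \<cdot> w') = w'"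
        using comp_left[OF m3(2), of w'] comp_left[OF m3(3), of w'] comp_left[OF m3(4), of w'] ts
        by simp
      moreover have "n \<cdot> t \<in> hom C (src C t) (src C e2) \<and> e2 \<cdot> (n \<cdot> t) = t"
        using comp_left[OF n(2), of t] by simp
      ultimately show ?thesis using ex2 by blast
    qed
    obtain g where g: "g \<in> arr C" "src C g = src C t" "tgt C g = R" "a \<cdot> g = g1" "r \<cdot> g = t"
      using pullback_lift[OF PR, of g1 "src C t" t] mg by auto
    note [simp] = g(1-3)
    obtain m' where m': "m' \<in> arr C" "src C m' = M" "tgt C m' = N" "s \<cdot> m' = g \<cdot> s'" "w \<cdot> m' = w'"
      using pullback_lift[OF PN, of "g \<cdot> s'" M w'] comp_left[OF g(5), of s'] ts by auto
    note [simp] = m'(1-3)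
    have "mm \<cdot> m' = m1"
      using pullback_eqI[OF P1, of "mm \<cdot> m'" m1] comp_left[OF mm(4), of m'] comp_left[OF mm(5), of m']
        comp_left[OF g(4), of s'] m'(4,5) m1(2,3) by simp
    then have ev_m': "(ev1 \<cdot> mm) \<cdot> m' = f" using m1(4) by simp
    show "\<exists>!g. g \<in> hom C (src C t) (src C r) \<and> r \<cdot> g = t \<and>
         (\<exists>m. m \<in> hom C M N \<and> s \<cdot> m = g \<cdot> s' \<and> w \<cdot> m = w' \<and> (ev1 \<cdot> mm) \<cdot> m = f)"
    proof (rule ex1I[of _ g])
      show "g \<in> hom C (src C t) (src C r) \<and> r \<cdot> g = t \<and>
         (\<exists>m. m \<in> hom C M N \<and> s \<cdot> m = g \<cdot> s' \<and> w \<cdot> m = w' \<and> (ev1 \<cdot> mm) \<cdot> m = f)"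
        using g(5) m'(4,5) ev_m' by (auto intro!: exI[of _ m'])
      fix h assume "h \<in> hom C (src C t) (src C r) \<and> r \<cdot> h = t \<and>
         (\<exists>m. m \<in> hom C M N \<and> s \<cdot> m = h \<cdot> s' \<and> w \<cdot> m = w' \<and> (ev1 \<cdot> mm) \<cdot> m = f)"
      then obtain k where h: "h \<in> hom C (src C t) (src C r)" "r \<cdot> h = t"
        and k: "k \<in> hom C M N" "s \<cdot> k = h \<cdot> s'" "w \<cdot> k = w'" "(ev1 \<cdot> mm) \<cdot> k = f"
        by (elim exE conjE) (rule that)
      note [simp] = h(1)[simplified] k(1)[simplified]
      have "a \<cdot> h \<in> hom C (src C t) (src C e1) \<and> e1 \<cdot> (a \<cdot> h) = t"
        using comp_left[OF e1a, of h] h(2) by simp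
      moreover have "mm \<cdot> k \<in> hom C M N1 \<and> s1 \<cdot> (mm \<cdot> k) = (a \<cdot> h) \<cdot> s' \<and> w1 \<cdot> (mm \<cdot> k) = w' \<and>
          ev1 \<cdot> (mm \<cdot> k) = f"
        using comp_left[OF mm(4), of k] comp_left[OF mm(5), of k] k(2-4) by simp
      moreover have "g1 \<in> hom C (src C t) (src C e1) \<and> e1 \<cdot> g1 = t" using g1 by simp
      moreover have "m1 \<in> hom C M N1 \<and> s1 \<cdot> m1 = g1 \<cdot> s' \<and> w1 \<cdot> m1 = w' \<and> ev1 \<cdot> m1 = f"
        using m1 by simp
      ultimately have "a \<cdot> h = g1" using ex1 by blast
      then show "h = g"
        using pullback_eqI[OF PR, of h g] h(2) g(4,5) by simp
    qed
  qed (simp_all add: PN q_ev)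
  then show thesis by (rule that)
qed

end
section \<open>Finite colimits and functors with a right adjoint\<close>

lemma finite_imp_small:
  assumes "smallness_cardinal \<kappa>" "finite A"
  shows "small \<kappa> A"
  using assms unfolding smallness_cardinal_def small_def
  by (auto intro!: finite_ordLess_infinite simp: card_order_on_well_order_on card_of_card_order_on Field_card_of)

context cat
begin

lemma pushout_exists:
  fixes \<kappa> :: "'u rel"
  assumes \<kappa>: "smallness_cardinal \<kappa>" and cc: "cocomplete \<kappa> C"
    and f: "f \<in> arr C" and g: "g \<in> arr C" "src C f = src C g"
  obtains P p q where "is_pushout C f g P p q"
proof -
  \<comment> \<open>The walking span has five arrows, which fit into the infinite type of \<open>\<kappa>\<close>.\<close>
  have "infinite (UNIV :: 'u set)"
    using \<kappa> unfolding smallness_cardinal_def by (auto dest: finite_subset[OF subset_UNIV])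
  then obtain e :: "nat \<Rightarrow> 'u" where "inj e"
    using infinite_countable_subset by blast
  then obtain a b c u v :: 'u where abc: "distinct [a, b, c, u, v]"
    using that[of "e 0" "e 1" "e 2" "e 3" "e 4"] by (simp add: inj_eq)
  define J :: "('u, 'u) cat" where
    "J = \<lparr>obj = {a, b, c}, arr = {a, b, c, u, v},
          src = (\<lambda>x. if x = u \<or> x = v then a else x),
          tgt = (\<lambda>x. if x = u then b else if x = v then c else x),
          idn = (\<lambda>x. x), cmp = (\<lambda>y x. if y = u \<or> y = v then y else x)\<rparr>"
  define F where
    "F = \<lparr>fob = (\<lambda>x. if x = a then src C f else if x = b then tgt C f else tgt C g),
          far = (\<lambda>x. if x = u then f else if x = v then g else if x = a then idn C (src C f)
                     else if x = b then idn C (tgt C f) else idn C (tgt C g))\<rparr>"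
  have homJ: "x \<in> hom J y z \<longleftrightarrow> x = a \<and> y = a \<and> z = a \<or> x = b \<and> y = b \<and> z = b \<or>
      x = c \<and> y = c \<and> z = c \<or> x = u \<and> y = a \<and> z = b \<or> x = v \<and> y = a \<and> z = c" for x y z
    using abc unfolding hom_def J_def by auto
  have J: "category J"
    unfolding category_def homJ using abc by (auto simp: J_def)
  note [simp] = f g
  have F: "is_functor J C F"
    unfolding is_functor_def homJ using abc by (auto simp: J_def F_def)
  have "finite (arr J)" by (simp add: J_def)
  then obtain P \<iota> where col: "is_colimit J C F P \<iota>"
    using cc J F finite_imp_small[OF \<kappa>] unfolding cocomplete_def by metis
  have F_simps: "fob F a = src C f" "fob F b = tgt C f" "fob F c = tgt C g"
    "far F a = idn C (src C f)" "far F b = idn C (tgt C f)" "far F c = idn C (tgt C g)" "far F u = f" "far F v = g"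
    using abc by (auto simp: F_def)
  have objJ: "obj J = {a, b, c}" by (simp add: J_def)
  have cocone: "is_cocone J C F Y \<tau> \<longleftrightarrow> \<tau> a \<in> hom C (src C f) Y \<and> \<tau> b \<in> hom C (tgt C f) Y \<and>
      \<tau> c \<in> hom C (tgt C g) Y \<and> \<tau> b \<cdot> f = \<tau> a \<and> \<tau> c \<cdot> g = \<tau> a" for Y \<tau>
    unfolding is_cocone_def homJ objJ by (auto simp: F_simps)
  have \<iota>: "\<iota> a \<in> hom C (src C f) P" "\<iota> b \<in> hom C (tgt C f) P" "\<iota> c \<in> hom C (tgt C g) P"
    "\<iota> b \<cdot> f = \<iota> a" "\<iota> c \<cdot> g = \<iota> a"
    using col unfolding is_colimit_def cocone by blast+
  have "is_pushout C f g P (\<iota> b) (\<iota> c)"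
    unfolding is_pushout_def
  proof (intro conjI allI impI)
    fix X s t assume s: "s \<in> hom C (tgt C f) X" and t: "t \<in> hom C (tgt C g) X" and eq: "s \<cdot> f = t \<cdot> g"
    define \<tau> where "\<tau> = (\<lambda>x. if x = a then s \<cdot> f else if x = b then s else t)"
    have \<tau>: "\<tau> a = s \<cdot> f" "\<tau> b = s" "\<tau> c = t" using abc by (auto simp: \<tau>_def)
    have "is_cocone J C F X \<tau>"
      unfolding cocone \<tau> using s t eq by auto
    then have ex: "\<exists>!h. h \<in> hom C P X \<and> (\<forall>j\<in>{a, b, c}. h \<cdot> \<iota> j = \<tau> j)"
      using col unfolding is_colimit_def objJ by blast
    have "(\<forall>j\<in>{a, b, c}. h \<cdot> \<iota> j = \<tau> j) \<longleftrightarrow> h \<cdot> \<iota> b = s \<and> h \<cdot> \<iota> c = t" if "h \<in> hom C P X" for h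
      using that \<iota>(1-3) comp_left[OF \<iota>(4), of "idn C (src C f)"] comp_assoc[of f "\<iota> b" h] \<iota>(4) f
      by (auto simp: \<tau> simp del: comp_assoc)
    then show "\<exists>!h. h \<in> hom C P X \<and> h \<cdot> \<iota> b = s \<and> h \<cdot> \<iota> c = t"
      using ex by (simp cong: conj_cong)
  qed (use \<iota> in auto)
  then show thesis by (rule that)
qed

lemma initial_exists:
  fixes \<kappa> :: "'u rel"
  assumes \<kappa>: "smallness_cardinal \<kappa>" and cc: "cocomplete \<kappa> C"
  obtains Z where "is_initial C Z"
proof -
  define J :: "('u, 'u) cat" where
    "J = \<lparr>obj = {}, arr = {}, src = (\<lambda>x. x), tgt = (\<lambda>x. x), idn = (\<lambda>x. x), cmp = (\<lambda>y x. x)\<rparr>"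
  define F :: "('u, 'u, 'o, 'a) cfunctor" where "F = \<lparr>fob = undefined, far = undefined\<rparr>"
  have J: "obj J = {}" "arr J = {}" "\<And>x y. hom J x y = {}" by (simp_all add: J_def hom_def)
  have "category J" "is_functor J C F"
    by (simp_all add: category_def is_functor_def J)
  then obtain Z \<iota> where "is_colimit J C F Z \<iota>"
    using cc finite_imp_small[OF \<kappa>, of "arr J"] J(2) unfolding cocomplete_def by (metis finite.emptyI)
  then have "is_initial C Z"
    unfolding is_colimit_def is_cocone_def is_initial_def J by blast
  then show thesis by (rule that)
qed

end

locale left_adjoint_endofunctor = cat +
  fixes I :: "('o, 'a, 'o, 'a) cfunctor"
  assumes endofunctor: "is_functor C C I"
    and adjoint: "has_right_adjoint C C I"
begin

lemma fob_obj [simp]: "X \<in> obj C \<Longrightarrow> fob I X \<in> obj C"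
  using endofunctor unfolding is_functor_def by blast

lemma far_arr [simp]: "f \<in> arr C \<Longrightarrow> far I f \<in> arr C"
  and src_far [simp]: "f \<in> arr C \<Longrightarrow> src C (far I f) = fob I (src C f)"
  and tgt_far [simp]: "f \<in> arr C \<Longrightarrow> tgt C (far I f) = fob I (tgt C f)"
  using endofunctor in_hom_iff[of f "src C f" "tgt C f"] in_hom_iff[of "far I f" "fob I (src C f)" "fob I (tgt C f)"]
  unfolding is_functor_def by blast+

lemma far_comp:
  "f \<in> arr C \<Longrightarrow> g \<in> arr C \<Longrightarrow> tgt C f = src C g \<Longrightarrow> far I (g \<cdot> f) = far I g \<cdot> far I f"
  using endofunctor unfolding is_functor_def hom_def by blast

lemma far_comp_eq:
  assumes "g \<cdot> f = k \<cdot> h" "f \<in> arr C" "g \<in> arr C" "h \<in> arr C" "k \<in> arr C" "tgt C f = src C g"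
    "tgt C h = src C k"
  shows "far I g \<cdot> far I f = far I k \<cdot> far I h"
  using assms by (metis far_comp)

text \<open>The form of the adjunction that is used: every object \<open>X\<close> has a couniversal arrow from \<open>I\<close>, the
  counit \<open>\<theta>\<close> at \<open>X\<close>.\<close>

lemma couniversal_arrow:
  assumes X: "X \<in> obj C"
  obtains Y \<theta> where "Y \<in> obj C" "\<theta> \<in> hom C (fob I Y) X"
    "\<And>A m. A \<in> obj C \<Longrightarrow> m \<in> hom C (fob I A) X \<Longrightarrow> \<exists>!n. n \<in> hom C A Y \<and> \<theta> \<cdot> far I n = m"
proof -
  obtain G \<eta> \<theta> where \<eta>: "nat_trans C C id_functor (comp_functor G I) \<eta>"
    and \<theta>: "nat_trans C C (comp_functor I G) id_functor \<theta>" and G: "is_functor C C G"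
    and tri1: "\<And>X. X \<in> obj C \<Longrightarrow> \<theta> (fob I X) \<cdot> far I (\<eta> X) = idn C (fob I X)"
    and tri2: "\<And>Y. Y \<in> obj C \<Longrightarrow> far G (\<theta> Y) \<cdot> \<eta> (fob G Y) = idn C (fob G Y)"
    using adjoint unfolding has_right_adjoint_def by blast
  have G_simps [simp]: "X \<in> obj C \<Longrightarrow> fob G X \<in> obj C" "f \<in> hom C X Y \<Longrightarrow> far G f \<in> hom C (fob G X) (fob G Y)"
    "f \<in> hom C X Y \<Longrightarrow> g \<in> hom C Y Z \<Longrightarrow> far G (g \<cdot> f) = far G g \<cdot> far G f" for X Y Z f g
    using G unfolding is_functor_def by blast+
  have \<eta>_hom: "X \<in> obj C \<Longrightarrow> \<eta> X \<in> hom C X (fob G (fob I X))"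
    and \<theta>_hom: "X \<in> obj C \<Longrightarrow> \<theta> X \<in> hom C (fob I (fob G X)) X"
    and \<eta>_nat: "f \<in> hom C X Y \<Longrightarrow> \<eta> Y \<cdot> f = far G (far I f) \<cdot> \<eta> X"
    and \<theta>_nat: "f \<in> hom C X Y \<Longrightarrow> \<theta> Y \<cdot> far I (far G f) = f \<cdot> \<theta> X" for X Y f
    using \<eta> \<theta> unfolding nat_trans_def comp_functor_def id_functor_def by auto
  show thesis
  proof (rule that[of "fob G X" "\<theta> X"])
    fix A m assume A: "A \<in> obj C" and m: "m \<in> hom C (fob I A) X"
    note [simp] = \<eta>_hom[OF A, simplified] \<theta>_hom[OF X, simplified] X A m[simplified]
      G_simps(2)[OF m, simplified] \<theta>_hom[OF fob_obj[OF A], simplified]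
      \<eta>_hom[OF G_simps(1)[OF X], simplified] G_simps(2)[OF \<theta>_hom[OF X], simplified]
    show "\<exists>!n. n \<in> hom C A (fob G X) \<and> \<theta> X \<cdot> far I n = m"
    proof (rule ex1I[of _ "far G m \<cdot> \<eta> A"])
      show "far G m \<cdot> \<eta> A \<in> hom C A (fob G X) \<and> \<theta> X \<cdot> far I (far G m \<cdot> \<eta> A) = m"
        using comp_left[OF \<theta>_nat[OF m], of "far I (\<eta> A)"] tri1[OF A] by (simp add: far_comp)
      fix n assume n: "n \<in> hom C A (fob G X) \<and> \<theta> X \<cdot> far I n = m"
      then have [simp]: "n \<in> arr C" "src C n = A" "tgt C n = fob G X" by auto
      have GIn: "far G (far I n) \<in> hom C (fob G (fob I A)) (fob G (fob I (fob G X)))"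
        by (rule G_simps(2)) simp
      note [simp] = GIn[simplified]
      have "far G m \<cdot> \<eta> A = (far G (\<theta> X) \<cdot> far G (far I n)) \<cdot> \<eta> A"
        using n G_simps(3)[of "far I n" "fob I A" "fob I (fob G X)" "\<theta> X" X] by simp
      also have "\<dots> = far G (\<theta> X) \<cdot> (\<eta> (fob G X) \<cdot> n)"
        using \<eta>_nat[of n A "fob G X"] by simp
      also have "\<dots> = n"
        using comp_left[OF tri2[OF X], of n] by simp
      finally show "n = far G m \<cdot> \<eta> A" ..
    qed
  qed (use X \<theta>_hom[OF X] in auto)
qed

lemma preserves_initial:
  assumes Z: "is_initial C Z"
  shows "is_initial C (fob I Z)"
  unfolding is_initial_def
proof (intro conjI ballI)
  have Zobj: "Z \<in> obj C" using Z unfolding is_initial_def by blast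
  then show "fob I Z \<in> obj C" by simp
  fix X assume "X \<in> obj C"
  then obtain Y \<theta> where Y: "Y \<in> obj C" "\<theta> \<in> hom C (fob I Y) X"
    and couniv: "\<And>A m. A \<in> obj C \<Longrightarrow> m \<in> hom C (fob I A) X \<Longrightarrow> \<exists>!n. n \<in> hom C A Y \<and> \<theta> \<cdot> far I n = m"
    using couniversal_arrow[of X] by metis
  have ex: "\<exists>!n. n \<in> hom C Z Y" using Z Y(1) unfolding is_initial_def by blast
  then obtain n where n: "n \<in> hom C Z Y" by blast
  then have "\<theta> \<cdot> far I n \<in> hom C (fob I Z) X" using Y(2) by auto
  moreover have "f = \<theta> \<cdot> far I n" if "f \<in> hom C (fob I Z) X" for f
    using couniv[OF Zobj that] ex n by metis
  ultimately show "\<exists>!f. f \<in> hom C (fob I Z) X" by blast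
qed

lemma preserves_pushout:
  assumes P: "is_pushout C f g P p q"
  shows "is_pushout C (far I f) (far I g) (fob I P) (far I p) (far I q)"
proof -
  note [simp] = pushoutD(1,2,4-9)[OF P]
  have sfg [simp]: "src C g = src C f" using pushoutD(3)[OF P] by simp
  have Pobj [simp]: "P \<in> obj C" using tgt_obj[of p] by simp
  show ?thesis
    unfolding is_pushout_def
  proof (intro conjI allI impI)
    show "far I p \<cdot> far I f = far I q \<cdot> far I g"
      by (rule far_comp_eq[OF pushoutD(10)[OF P]]) simp_all
    fix X u v
    assume u: "u \<in> hom C (tgt C (far I f)) X" and v: "v \<in> hom C (tgt C (far I g)) X"
      and eq: "u \<cdot> far I f = v \<cdot> far I g"
    have "X \<in> obj C" using u by auto
    then obtain Y \<theta> where Y: "Y \<in> obj C" "\<theta> \<in> hom C (fob I Y) X"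
      and couniv: "\<And>A m. A \<in> obj C \<Longrightarrow> m \<in> hom C (fob I A) X \<Longrightarrow> \<exists>!n. n \<in> hom C A Y \<and> \<theta> \<cdot> far I n = m"
      using couniversal_arrow[of X] by metis
    note [simp] = u[simplified] v[simplified] Y(1) Y(2)[simplified]
    obtain u' where u': "u' \<in> arr C" "src C u' = tgt C f" "tgt C u' = Y" "\<theta> \<cdot> far I u' = u"
      using couniv[of "tgt C f" u] by auto
    obtain v' where v': "v' \<in> arr C" "src C v' = tgt C g" "tgt C v' = Y" "\<theta> \<cdot> far I v' = v"
      using couniv[of "tgt C g" v] by auto
    note [simp] = u'(1-3) v'(1-3)
    have inj: "n = n'" if n: "n \<in> hom C A Y" "n' \<in> hom C A Y" "\<theta> \<cdot> far I n = \<theta> \<cdot> far I n'" for n n' A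
    proof -
      have "A \<in> obj C" "\<theta> \<cdot> far I n \<in> hom C (fob I A) X" using n(1) by auto
      from couniv[OF this] n show ?thesis by metis
    qed
    have "u' \<cdot> f = v' \<cdot> g"
    proof (rule inj[of _ "src C f"])
      show "\<theta> \<cdot> far I (u' \<cdot> f) = \<theta> \<cdot> far I (v' \<cdot> g)"
        using comp_left[OF u'(4), of "far I f"] comp_left[OF v'(4), of "far I g"] eq
        by (simp add: far_comp)
    qed simp_all
    then obtain h where h: "h \<in> arr C" "src C h = P" "tgt C h = Y" "h \<cdot> p = u'" "h \<cdot> q = v'"
      using pushout_desc[OF P, of u' Y v'] by auto
    note [simp] = h(1-3)
    show "\<exists>!h. h \<in> hom C (fob I P) X \<and> h \<cdot> far I p = u \<and> h \<cdot> far I q = v"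
    proof (rule ex1I[of _ "\<theta> \<cdot> far I h"])
      show "\<theta> \<cdot> far I h \<in> hom C (fob I P) X \<and> (\<theta> \<cdot> far I h) \<cdot> far I p = u \<and> (\<theta> \<cdot> far I h) \<cdot> far I q = v"
        using u'(4) v'(4) h(4,5) far_comp[of p h] far_comp[of q h] by simp
      fix k assume k: "k \<in> hom C (fob I P) X \<and> k \<cdot> far I p = u \<and> k \<cdot> far I q = v"
      then have [simp]: "k \<in> arr C" "src C k = fob I P" "tgt C k = X" by auto
      have "k \<in> hom C (fob I P) X" by simp
      from couniv[OF Pobj this] obtain k' where k': "k' \<in> hom C P Y" "\<theta> \<cdot> far I k' = k"
        by (elim ex1E conjE) (rule that)
      note [simp] = k'(1)[simplified]
      have "k' \<cdot> p = u'"
        by (rule inj[of _ "tgt C f"])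
          (use k u'(4) comp_left[OF k'(2), of "far I p"] in \<open>simp_all add: far_comp\<close>)
      moreover have "k' \<cdot> q = v'"
        by (rule inj[of _ "tgt C g"])
          (use k v'(4) comp_left[OF k'(2), of "far I q"] in \<open>simp_all add: far_comp\<close>)
      ultimately have "k' = h" using pushout_eqI[OF P, of k' h] h(4,5) by simp
      with k'(2) show "k = \<theta> \<cdot> far I h" by simp
    qed
  qed simp_all
qed

end
section \<open>Filling open boxes\<close>

text \<open>This is lifting of the Leibniz product of \<open>d\<close> with \<open>i\<close> against \<open>p\<close>, with a map out of the pushout
  given by its two components \<open>a\<close> and \<open>b\<close>, so that no pushout has to be chosen.\<close>

definition fills_boxes ::
    "('o, 'a) cat \<Rightarrow> ('o, 'a, 'o, 'a) cfunctor \<Rightarrow> ('o \<Rightarrow> 'a) \<Rightarrow> 'a \<Rightarrow> 'a \<Rightarrow> bool" where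
  "fills_boxes C I d i p \<longleftrightarrow>
     (\<forall>a b y. a \<in> hom C (fob I (src C i)) (src C p) \<longrightarrow> b \<in> hom C (tgt C i) (src C p) \<longrightarrow>
        y \<in> hom C (fob I (tgt C i)) (tgt C p) \<longrightarrow> cmp C a (d (src C i)) = cmp C b i \<longrightarrow>
        cmp C p a = cmp C y (far I i) \<longrightarrow> cmp C p b = cmp C y (d (tgt C i)) \<longrightarrow>
        (\<exists>h. h \<in> hom C (fob I (tgt C i)) (src C p) \<and> cmp C h (far I i) = a \<and>
           cmp C h (d (tgt C i)) = b \<and> cmp C p h = y))"

locale endpoint = left_adjoint_endofunctor + lcc_cat +
  fixes \<delta> :: "nat \<Rightarrow> 'o \<Rightarrow> 'a" and k :: nat
  assumes endpoint: "nat_trans C C id_functor I (\<delta> k)"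
begin

lemma endpoint_arr [simp]: "X \<in> obj C \<Longrightarrow> \<delta> k X \<in> arr C"
  and src_endpoint [simp]: "X \<in> obj C \<Longrightarrow> src C (\<delta> k X) = X"
  and tgt_endpoint [simp]: "X \<in> obj C \<Longrightarrow> tgt C (\<delta> k X) = fob I X"
  using endpoint unfolding nat_trans_def id_functor_def by auto

lemma endpoint_natural:
  "f \<in> arr C \<Longrightarrow> X = src C f \<Longrightarrow> far I f \<cdot> \<delta> k X = \<delta> k (tgt C f) \<cdot> f"
  using endpoint unfolding nat_trans_def id_functor_def by simp

lemma leibniz_product_exists:
  assumes [simp]: "i \<in> arr C" and P: "is_pushout C (\<delta> k (src C i)) i P p q"
  obtains h where "is_leibniz_product C I \<delta> k i h"
proof -
  obtain h where "h \<in> arr C" "src C h = P" "tgt C h = fob I (tgt C i)" "h \<cdot> p = far I i"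
      "h \<cdot> q = \<delta> k (tgt C i)"
    using pushout_desc[OF P, of "far I i" "fob I (tgt C i)" "\<delta> k (tgt C i)"]
    by (auto simp: endpoint_natural)
  then show thesis using P that unfolding is_leibniz_product_def by auto
qed

lemma fills_boxes_if_lifts_against_leibniz_product:
  assumes h: "is_leibniz_product C I \<delta> k i h" and lift: "lifts_against C h p"
    and [simp]: "i \<in> arr C" "p \<in> arr C"
  shows "fills_boxes C I (\<delta> k) i p"
  unfolding fills_boxes_def
proof (intro allI impI)
  fix a b y
  assume a: "a \<in> hom C (fob I (src C i)) (src C p)" and b: "b \<in> hom C (tgt C i) (src C p)"
    and y: "y \<in> hom C (fob I (tgt C i)) (tgt C p)" and eq: "a \<cdot> \<delta> k (src C i) = b \<cdot> i"
      "p \<cdot> a = y \<cdot> far I i" "p \<cdot> b = y \<cdot> \<delta> k (tgt C i)"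
  note [simp] = a[simplified] b[simplified] y[simplified]
  obtain P l r where P: "is_pushout C (\<delta> k (src C i)) i P l r" and
    hP: "h \<in> hom C P (fob I (tgt C i))" "h \<cdot> l = far I i" "h \<cdot> r = \<delta> k (tgt C i)"
    using h unfolding is_leibniz_product_def by blast
  note [simp] = pushoutD(1,2,4-9)[OF P] hP(1)[simplified]
  obtain u where u: "u \<in> arr C" "src C u = P" "tgt C u = src C p" "u \<cdot> l = a" "u \<cdot> r = b"
    by (rule pushout_desc[OF P, of a "src C p" b]) (simp_all add: eq)
  note [simp] = u(1-3)
  have "p \<cdot> u = y \<cdot> h"
    using pushout_eqI[OF P, of "p \<cdot> u" "y \<cdot> h"] u(4,5) hP(2,3) eq by simp
  then obtain g where g: "g \<in> hom C (tgt C h) (src C p)" "g \<cdot> h = u" "p \<cdot> g = y"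
    using lift unfolding lifts_against_def
    by (elim allE[where x = u] allE[where x = y]) auto
  note [simp] = g(1)[simplified]
  show "\<exists>h. h \<in> hom C (fob I (tgt C i)) (src C p) \<and> h \<cdot> far I i = a \<and> h \<cdot> \<delta> k (tgt C i) = b \<and> p \<cdot> h = y"
    using comp_left[OF g(2), of l] comp_left[OF g(2), of r] hP u(4,5) g(3)
    by (intro exI[of _ g]) simp
qed

text \<open>Transposing along the adjunction, box filling against \<open>p : X \<rightarrow> Y\<close> becomes lifting against the gap map
  from \<open>G X\<close> to the pullback of \<open>p\<close> and the evaluation \<open>G Y \<rightarrow> Y\<close> at the endpoint, where \<open>G\<close> is the
  right adjoint of \<open>I\<close>. So the maps \<open>i\<close> against which \<open>p\<close> fills boxes are characterized by lifting
  against a single map.\<close>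

lemma fills_boxes_iff_lifts_against_gap_map:
  assumes [simp]: "p \<in> arr C"
  obtains g where "g \<in> arr C" "\<And>i. i \<in> arr C \<Longrightarrow> fills_boxes C I (\<delta> k) i p \<longleftrightarrow> lifts_against C i g"
proof -
  let ?X = "src C p" and ?Y = "tgt C p"
  obtain GX \<theta>X where GX: "GX \<in> obj C" "\<theta>X \<in> hom C (fob I GX) ?X"
    and univX: "\<And>A m. A \<in> obj C \<Longrightarrow> m \<in> hom C (fob I A) ?X \<Longrightarrow> \<exists>!n. n \<in> hom C A GX \<and> \<theta>X \<cdot> far I n = m"
    using couniversal_arrow[of ?X] by (metis assms src_obj)
  obtain GY \<theta>Y where GY: "GY \<in> obj C" "\<theta>Y \<in> hom C (fob I GY) ?Y"
    and univY: "\<And>A m. A \<in> obj C \<Longrightarrow> m \<in> hom C (fob I A) ?Y \<Longrightarrow> \<exists>!n. n \<in> hom C A GY \<and> \<theta>Y \<cdot> far I n = m"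
    using couniversal_arrow[of ?Y] by (metis assms tgt_obj)
  note [simp] = GX(1) GX(2)[simplified] GY(1) GY(2)[simplified]
  have injX: "n = n'" if n: "n \<in> hom C A GX" "n' \<in> hom C A GX" "\<theta>X \<cdot> far I n = \<theta>X \<cdot> far I n'" for n n' A
  proof -
    have "A \<in> obj C" "\<theta>X \<cdot> far I n \<in> hom C (fob I A) ?X" using n(1) by auto
    from univX[OF this] n show ?thesis by metis
  qed
  have injY: "n = n'" if n: "n \<in> hom C A GY" "n' \<in> hom C A GY" "\<theta>Y \<cdot> far I n = \<theta>Y \<cdot> far I n'" for n n' A
  proof -
    have "A \<in> obj C" "\<theta>Y \<cdot> far I n \<in> hom C (fob I A) ?Y" using n(1) by auto
    from univY[OF this] n show ?thesis by metis
  qed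
  have "p \<cdot> \<theta>X \<in> hom C (fob I GX) ?Y" by simp
  from univY[OF GX(1) this] obtain Gp where Gp: "Gp \<in> hom C GX GY" "\<theta>Y \<cdot> far I Gp = p \<cdot> \<theta>X"
    by (elim ex1E conjE) (rule that)
  note [simp] = Gp(1)[simplified]
  define eX eY where "eX = \<theta>X \<cdot> \<delta> k GX" and "eY = \<theta>Y \<cdot> \<delta> k GY"
  have e [simp]: "eX \<in> arr C" "src C eX = GX" "tgt C eX = ?X" "eY \<in> arr C" "src C eY = GY" "tgt C eY = ?Y"
    by (simp_all add: eX_def eY_def)
  have eX: "eX \<cdot> n = (\<theta>X \<cdot> far I n) \<cdot> \<delta> k (src C n)" if "n \<in> arr C" "tgt C n = GX" for n
    using that endpoint_natural[of n] by (simp add: eX_def)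
  have eY: "eY \<cdot> n = (\<theta>Y \<cdot> far I n) \<cdot> \<delta> k (src C n)" if "n \<in> arr C" "tgt C n = GY" for n
    using that endpoint_natural[of n] by (simp add: eY_def)
  have Gp_comp: "\<theta>Y \<cdot> far I (Gp \<cdot> n) = p \<cdot> (\<theta>X \<cdot> far I n)" if "n \<in> arr C" "tgt C n = GX" for n
    using that comp_left[OF Gp(2), of "far I n"] far_comp[of n Gp] by simp
  have pe: "p \<cdot> eX = eY \<cdot> Gp"
    using eY[of Gp] Gp(2) by (simp add: eX_def)
  obtain K k1 k2 where K: "is_pullback C p eY K k1 k2"
    using pullback_exists[of p eY] by auto
  note [simp] = pullbackD(4-9)[OF K]
  have pk1: "p \<cdot> k1 = eY \<cdot> k2" by (rule pullbackD(10)[OF K])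
  obtain g where g: "g \<in> arr C" "src C g = GX" "tgt C g = K" "k1 \<cdot> g = eX" "k2 \<cdot> g = Gp"
    by (rule pullback_lift[OF K, of eX GX Gp]) (simp_all add: pe)
  note [simp] = g(1-3)
  show thesis
  proof (rule that[OF g(1)])
    fix i assume [simp]: "i \<in> arr C"
    let ?A = "src C i" and ?B = "tgt C i"
    have AB: "?A \<in> obj C" "?B \<in> obj C" by simp_all
    show "fills_boxes C I (\<delta> k) i p \<longleftrightarrow> lifts_against C i g"
    proof
      assume fill: "fills_boxes C I (\<delta> k) i p"
      show "lifts_against C i g"
        unfolding lifts_against_def
      proof (intro allI impI)
        fix u v assume u: "u \<in> hom C ?A (src C g)" and v: "v \<in> hom C ?B (tgt C g)" and gu: "g \<cdot> u = v \<cdot> i"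
        note [simp] = u[simplified] v[simplified]
        have eXu: "eX \<cdot> u = k1 \<cdot> (v \<cdot> i)" and Gpu: "Gp \<cdot> u = k2 \<cdot> (v \<cdot> i)"
          using comp_left[OF g(4), of u] comp_left[OF g(5), of u] gu by simp_all
        have "\<exists>h. h \<in> hom C (fob I ?B) ?X \<and> h \<cdot> far I i = \<theta>X \<cdot> far I u \<and> h \<cdot> \<delta> k ?B = k1 \<cdot> v \<and>
            p \<cdot> h = \<theta>Y \<cdot> far I (k2 \<cdot> v)"
        proof (rule fill[unfolded fills_boxes_def, rule_format])
          show "(\<theta>X \<cdot> far I u) \<cdot> \<delta> k ?A = (k1 \<cdot> v) \<cdot> i"
            using eX[of u] eXu by simp
          show "p \<cdot> (\<theta>X \<cdot> far I u) = (\<theta>Y \<cdot> far I (k2 \<cdot> v)) \<cdot> far I i"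
            using Gp_comp[of u] Gpu far_comp[of i "k2 \<cdot> v"] by simp
          show "p \<cdot> (k1 \<cdot> v) = (\<theta>Y \<cdot> far I (k2 \<cdot> v)) \<cdot> \<delta> k ?B"
            using comp_left[OF pk1, of v] eY[of "k2 \<cdot> v"] by simp
        qed simp_all
        then obtain h where h: "h \<in> hom C (fob I ?B) ?X" "h \<cdot> far I i = \<theta>X \<cdot> far I u"
          "h \<cdot> \<delta> k ?B = k1 \<cdot> v" "p \<cdot> h = \<theta>Y \<cdot> far I (k2 \<cdot> v)" by blast
        note [simp] = h(1)[simplified]
        from univX[OF AB(2) h(1)] obtain h' where h': "h' \<in> hom C ?B GX" "\<theta>X \<cdot> far I h' = h"
          by (elim ex1E conjE) (rule that)
        note [simp] = h'(1)[simplified]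
        have "h' \<cdot> i = u"
          by (rule injX[of _ ?A])
            (use h(2) comp_left[OF h'(2), of "far I i"] in \<open>simp_all add: far_comp\<close>)
        moreover have "g \<cdot> h' = v"
        proof (rule pullback_eqI[OF K])
          show "k1 \<cdot> (g \<cdot> h') = k1 \<cdot> v"
            using comp_left[OF g(4), of h'] eX[of h'] h'(2) h(3) by simp
          have "Gp \<cdot> h' = k2 \<cdot> v"
            by (rule injY[of _ ?B]) (use Gp_comp[of h'] h'(2) h(4) in simp_all)
          then show "k2 \<cdot> (g \<cdot> h') = k2 \<cdot> v"
            using comp_left[OF g(5), of h'] by simp
        qed simp_all
        ultimately show "\<exists>h. h \<in> hom C ?B (src C g) \<and> h \<cdot> i = u \<and> g \<cdot> h = v"
          by (intro exI[of _ h']) simp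
      qed
    next
      assume lift: "lifts_against C i g"
      show "fills_boxes C I (\<delta> k) i p"
        unfolding fills_boxes_def
      proof (intro allI impI)
        fix a b y
        assume a: "a \<in> hom C (fob I ?A) ?X" and b: "b \<in> hom C ?B ?X"
          and y: "y \<in> hom C (fob I ?B) ?Y" and eq: "a \<cdot> \<delta> k ?A = b \<cdot> i"
            "p \<cdot> a = y \<cdot> far I i" "p \<cdot> b = y \<cdot> \<delta> k ?B"
        note [simp] = a[simplified] b[simplified] y[simplified]
        from univX[OF AB(1) a] obtain u where u: "u \<in> hom C ?A GX" "\<theta>X \<cdot> far I u = a"
          by (elim ex1E conjE) (rule that)
        from univY[OF AB(2) y] obtain y' where y': "y' \<in> hom C ?B GY" "\<theta>Y \<cdot> far I y' = y"
          by (elim ex1E conjE) (rule that)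
        note [simp] = u(1)[simplified] y'(1)[simplified]
        obtain v where v: "v \<in> arr C" "src C v = ?B" "tgt C v = K" "k1 \<cdot> v = b" "k2 \<cdot> v = y'"
          by (rule pullback_lift[OF K, of b ?B y']) (simp_all add: eq eY y'(2))
        note [simp] = v(1-3)
        have "g \<cdot> u = v \<cdot> i"
        proof (rule pullback_eqI[OF K])
          show "k1 \<cdot> (g \<cdot> u) = k1 \<cdot> (v \<cdot> i)"
            using comp_left[OF g(4), of u] comp_left[OF v(4), of i] eX[of u] u(2) eq(1) by simp
          have "Gp \<cdot> u = y' \<cdot> i"
            by (rule injY[of _ ?A])
              (use Gp_comp[of u] u(2) eq(2) comp_left[OF y'(2), of "far I i"] far_comp[of i y'] in simp_all)
          then show "k2 \<cdot> (g \<cdot> u) = k2 \<cdot> (v \<cdot> i)"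
            using comp_left[OF g(5), of u] comp_left[OF v(5), of i] by simp
        qed simp_all
        then obtain l where l: "l \<in> hom C ?B (src C g)" "l \<cdot> i = u" "g \<cdot> l = v"
          using lift unfolding lifts_against_def
          by (elim allE[where x = u] allE[where x = v]) auto
        note [simp] = l(1)[simplified]
        have "Gp \<cdot> l = y'" "eX \<cdot> l = b"
          using comp_left[OF g(5), of l] comp_left[OF g(4), of l] l(3) v(4,5) by simp_all
        then show "\<exists>h. h \<in> hom C (fob I ?B) ?X \<and> h \<cdot> far I i = a \<and> h \<cdot> \<delta> k ?B = b \<and> p \<cdot> h = y"
          using l(2) u(2) far_comp[of i l] eX[of l] Gp_comp[of l] y'(2)
          by (intro exI[of _ "\<theta>X \<cdot> far I l"]) simp
      qed
    qed
  qed
qed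

text \<open>If boxes against the generators have fillings then the gap map is a trivial fibration.\<close>

lemma fills_boxes_extends_to_cofibrations:
  assumes p: "p \<in> arr C" and gen: "G \<subseteq> arr C" "\<And>i. i \<in> G \<Longrightarrow> fills_boxes C I (\<delta> k) i p"
    and i: "i \<in> llp C (rlp C G)"
  shows "fills_boxes C I (\<delta> k) i p"
proof -
  obtain g where g: "g \<in> arr C" "\<And>i. i \<in> arr C \<Longrightarrow> fills_boxes C I (\<delta> k) i p \<longleftrightarrow> lifts_against C i g"
    using fills_boxes_iff_lifts_against_gap_map[OF p] by metis
  then have "g \<in> rlp C G" using gen unfolding rlp_def by auto
  then show ?thesis using i g unfolding llp_def by auto
qed

text \<open>The Leibniz product of an endpoint with \<open>0 \<rightarrow> X\<close> is the endpoint inclusion of \<open>X\<close>.\<close>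

lemma lifts_against_endpoint:
  assumes Z: "is_initial C Z" and z: "z \<in> hom C Z X" and fill: "fills_boxes C I (\<delta> k) z p"
    and [simp]: "p \<in> arr C"
  shows "lifts_against C (\<delta> k X) p"
  unfolding lifts_against_def
proof (intro allI impI)
  note [simp] = z[simplified]
  have [simp]: "X \<in> obj C" "Z \<in> obj C" using tgt_obj[of z] src_obj[of z] by simp_all
  fix u v assume u: "u \<in> hom C (src C (\<delta> k X)) (src C p)" and v: "v \<in> hom C (tgt C (\<delta> k X)) (tgt C p)"
    and eq: "p \<cdot> u = v \<cdot> \<delta> k X"
  note [simp] = u[simplified] v[simplified]
  have uniq: "f = g" if "is_initial C W" "f \<in> hom C W Y" "g \<in> hom C W Y" for W Y f g
  proof -
    have "Y \<in> obj C" using that(2) by auto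
    with that show ?thesis unfolding is_initial_def by blast
  qed
  have "src C p \<in> obj C" by simp
  then obtain a where a: "a \<in> hom C (fob I Z) (src C p)"
    using preserves_initial[OF Z] unfolding is_initial_def by blast
  note [simp] = a[simplified]
  have "\<exists>h. h \<in> hom C (fob I (tgt C z)) (src C p) \<and> h \<cdot> far I z = a \<and> h \<cdot> \<delta> k (tgt C z) = u \<and> p \<cdot> h = v"
  proof (rule fill[unfolded fills_boxes_def, rule_format])
    show "a \<cdot> \<delta> k (src C z) = u \<cdot> z"
      by (rule uniq[OF Z]) simp_all
    show "p \<cdot> a = v \<cdot> far I z"
      by (rule uniq[OF preserves_initial[OF Z]]) simp_all
  qed (simp_all add: eq)
  then show "\<exists>h. h \<in> hom C (tgt C (\<delta> k X)) (src C p) \<and> h \<cdot> \<delta> k X = u \<and> p \<cdot> h = v"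
    by auto
qed

end
section \<open>Strong homotopy equivalences\<close>

text \<open>A map \<open>f\<close> with a homotopy inverse \<open>g\<close> and homotopies \<open>\<phi> : g f \<sim> 1\<close> and \<open>\<psi> : f g \<sim> 1\<close>, running
  from the endpoint \<open>d\<close> to the endpoint \<open>d'\<close>; it is strong in that \<open>f\<close> carries \<open>\<phi>\<close> to \<open>\<psi>\<close>.
  Equivalently, \<open>f\<close> is a retract of its Leibniz product with \<open>d\<close>, along the sections induced by \<open>d'\<close>.\<close>

definition strong_homotopy_equivalence ::
    "('o, 'a) cat \<Rightarrow> ('o, 'a, 'o, 'a) cfunctor \<Rightarrow> ('o \<Rightarrow> 'a) \<Rightarrow> ('o \<Rightarrow> 'a) \<Rightarrow> 'a \<Rightarrow> bool" where
  "strong_homotopy_equivalence C I d d' f \<longleftrightarrow>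
     f \<in> arr C \<and>
     (\<exists>g \<phi> \<psi>. g \<in> hom C (tgt C f) (src C f) \<and> \<phi> \<in> hom C (fob I (src C f)) (src C f) \<and>
        \<psi> \<in> hom C (fob I (tgt C f)) (tgt C f) \<and>
        cmp C \<phi> (d (src C f)) = cmp C g f \<and> cmp C \<phi> (d' (src C f)) = idn C (src C f) \<and>
        cmp C \<psi> (d (tgt C f)) = cmp C f g \<and> cmp C \<psi> (d' (tgt C f)) = idn C (tgt C f) \<and>
        cmp C f \<phi> = cmp C \<psi> (far I f))"

locale oriented_cylinder = endpoint + opposite: endpoint C I \<delta> l for l
begin

abbreviation she where "she \<equiv> strong_homotopy_equivalence C I (\<delta> k) (\<delta> l)"

lemma sheE:
  assumes "she f"
  obtains g \<phi> \<psi> where "g \<in> hom C (tgt C f) (src C f)" "\<phi> \<in> hom C (fob I (src C f)) (src C f)"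
    "\<psi> \<in> hom C (fob I (tgt C f)) (tgt C f)"
    "\<phi> \<cdot> \<delta> k (src C f) = g \<cdot> f" "\<phi> \<cdot> \<delta> l (src C f) = idn C (src C f)"
    "\<psi> \<cdot> \<delta> k (tgt C f) = f \<cdot> g" "\<psi> \<cdot> \<delta> l (tgt C f) = idn C (tgt C f)" "f \<cdot> \<phi> = \<psi> \<cdot> far I f"
  using assms unfolding strong_homotopy_equivalence_def by (elim exE conjE) (rule that)

text \<open>Given a square from \<open>f\<close> to \<open>p\<close>, the homotopies of \<open>f\<close> define an open box in \<open>p\<close>; the far end of a
  filling is a diagonal of the square.\<close>

lemma she_lifts_against:
  assumes f: "she f" and fill: "fills_boxes C I (\<delta> k) f p" and [simp]: "p \<in> arr C"
  shows "lifts_against C f p"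
  unfolding lifts_against_def
proof (intro allI impI)
  fix u v assume u: "u \<in> hom C (src C f) (src C p)" and v: "v \<in> hom C (tgt C f) (tgt C p)"
    and eq: "p \<cdot> u = v \<cdot> f"
  have [simp]: "f \<in> arr C" using f unfolding strong_homotopy_equivalence_def by blast
  obtain g \<phi> \<psi> where hom: "g \<in> hom C (tgt C f) (src C f)" "\<phi> \<in> hom C (fob I (src C f)) (src C f)"
    "\<psi> \<in> hom C (fob I (tgt C f)) (tgt C f)"
    and s: "\<phi> \<cdot> \<delta> k (src C f) = g \<cdot> f" "\<phi> \<cdot> \<delta> l (src C f) = idn C (src C f)"
    "\<psi> \<cdot> \<delta> k (tgt C f) = f \<cdot> g" "\<psi> \<cdot> \<delta> l (tgt C f) = idn C (tgt C f)" "f \<cdot> \<phi> = \<psi> \<cdot> far I f"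
    by (rule sheE[OF f])
  note [simp] = hom[simplified] u[simplified] v[simplified]
  have "\<exists>h. h \<in> hom C (fob I (tgt C f)) (src C p) \<and> h \<cdot> far I f = u \<cdot> \<phi> \<and> h \<cdot> \<delta> k (tgt C f) = u \<cdot> g \<and>
      p \<cdot> h = v \<cdot> \<psi>"
    by (rule fill[unfolded fills_boxes_def, rule_format])
      (simp_all add: s comp_left[OF eq])
  then obtain h where h: "h \<in> hom C (fob I (tgt C f)) (src C p)" "h \<cdot> far I f = u \<cdot> \<phi>" "p \<cdot> h = v \<cdot> \<psi>"
    by blast
  note [simp] = h(1)[simplified]
  have "(h \<cdot> \<delta> l (tgt C f)) \<cdot> f = u"
    using opposite.endpoint_natural[of f] comp_left[OF h(2), of "\<delta> l (src C f)"] s(2) by simp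
  moreover have "p \<cdot> (h \<cdot> \<delta> l (tgt C f)) = v"
    using comp_left[OF h(3), of "\<delta> l (tgt C f)"] s(4) by simp
  ultimately show "\<exists>h. h \<in> hom C (tgt C f) (src C p) \<and> h \<cdot> f = u \<and> p \<cdot> h = v"
    by (intro exI[of _ "h \<cdot> \<delta> l (tgt C f)"]) simp
qed

text \<open>Only \<open>\<psi>\<close> has to be lifted, starting from its far end, where it is the identity: since \<open>f\<close> is strong,
  the universal property of the pullback then yields the inverse and the other homotopy.\<close>

lemma she_pullback:
  assumes f: "she f" and P: "is_pullback C f p P u v"
    and lift: "lifts_against C (\<delta> l (src C p)) p"
  shows "she v"
proof -
  obtain g \<phi> \<psi> where hom: "g \<in> hom C (tgt C f) (src C f)" "\<phi> \<in> hom C (fob I (src C f)) (src C f)"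
    "\<psi> \<in> hom C (fob I (tgt C f)) (tgt C f)"
    and s: "\<phi> \<cdot> \<delta> k (src C f) = g \<cdot> f" "\<phi> \<cdot> \<delta> l (src C f) = idn C (src C f)"
    "\<psi> \<cdot> \<delta> k (tgt C f) = f \<cdot> g" "\<psi> \<cdot> \<delta> l (tgt C f) = idn C (tgt C f)" "f \<cdot> \<phi> = \<psi> \<cdot> far I f"
    by (rule sheE[OF f])
  note [simp] = pullbackD(1,2,4-9)[OF P] hom[simplified]
  have [simp]: "tgt C p = tgt C f" using pullbackD(3)[OF P] by simp
  have fu: "f \<cdot> u = p \<cdot> v" by (rule pullbackD(10)[OF P])
  let ?Q = "src C p"
  have Qobj [simp]: "?Q \<in> obj C" by simp
  have Pobj [simp]: "P \<in> obj C" using src_obj[of v] by simp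
  have "\<exists>h. h \<in> hom C (fob I ?Q) ?Q \<and> h \<cdot> \<delta> l ?Q = idn C ?Q \<and> p \<cdot> h = \<psi> \<cdot> far I p"
    using lift opposite.endpoint_natural[of p ?Q] comp_left[OF s(4), of p] unfolding lifts_against_def
    by (elim allE[where x = "idn C ?Q"] allE[where x = "\<psi> \<cdot> far I p"]) simp
  then obtain \<psi>' where \<psi>': "\<psi>' \<in> hom C (fob I ?Q) ?Q" "\<psi>' \<cdot> \<delta> l ?Q = idn C ?Q" "p \<cdot> \<psi>' = \<psi> \<cdot> far I p"
    by blast
  note [simp] = \<psi>'(1)[simplified]
  have far_fu: "far I f \<cdot> far I u = far I p \<cdot> far I v"
    by (rule far_comp_eq[OF fu]) simp_all
  have "f \<cdot> (\<phi> \<cdot> far I u) = p \<cdot> (\<psi>' \<cdot> far I v)"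
    using comp_left[OF s(5), of "far I u"] comp_left[OF \<psi>'(3), of "far I v"] far_fu by simp
  then obtain \<phi>' where \<phi>': "\<phi>' \<in> arr C" "src C \<phi>' = fob I P" "tgt C \<phi>' = P" "u \<cdot> \<phi>' = \<phi> \<cdot> far I u"
      "v \<cdot> \<phi>' = \<psi>' \<cdot> far I v"
    by (rule pullback_lift[OF P, of "\<phi> \<cdot> far I u" "fob I P" "\<psi>' \<cdot> far I v", rotated 2]) simp_all
  note [simp] = \<phi>'(1-3)
  have "f \<cdot> (g \<cdot> p) = p \<cdot> (\<psi>' \<cdot> \<delta> k ?Q)"
    using comp_left[OF \<psi>'(3), of "\<delta> k ?Q"] endpoint_natural[of p ?Q] comp_left[OF s(3), of p] by simp
  then obtain g' where g': "g' \<in> arr C" "src C g' = ?Q" "tgt C g' = P" "u \<cdot> g' = g \<cdot> p"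
      "v \<cdot> g' = \<psi>' \<cdot> \<delta> k ?Q"
    by (rule pullback_lift[OF P, of "g \<cdot> p" ?Q "\<psi>' \<cdot> \<delta> k ?Q", rotated 2]) simp_all
  note [simp] = g'(1-3)
  have near: "\<phi>' \<cdot> \<delta> k P = g' \<cdot> v"
  proof (rule pullback_eqI[OF P])
    show "u \<cdot> (\<phi>' \<cdot> \<delta> k P) = u \<cdot> (g' \<cdot> v)"
      using comp_left[OF \<phi>'(4), of "\<delta> k P"] comp_left[OF g'(4), of v] endpoint_natural[of u P]
        comp_left[OF s(1), of u] fu by simp
    show "v \<cdot> (\<phi>' \<cdot> \<delta> k P) = v \<cdot> (g' \<cdot> v)"
      using comp_left[OF \<phi>'(5), of "\<delta> k P"] comp_left[OF g'(5), of v] endpoint_natural[of v P] by simp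
  qed simp_all
  have far: "\<phi>' \<cdot> \<delta> l P = idn C P"
  proof (rule pullback_eqI[OF P])
    show "u \<cdot> (\<phi>' \<cdot> \<delta> l P) = u \<cdot> idn C P"
      using comp_left[OF \<phi>'(4), of "\<delta> l P"] opposite.endpoint_natural[of u P] comp_left[OF s(2), of u]
      by simp
    show "v \<cdot> (\<phi>' \<cdot> \<delta> l P) = v \<cdot> idn C P"
      using comp_left[OF \<phi>'(5), of "\<delta> l P"] opposite.endpoint_natural[of v P] comp_left[OF \<psi>'(2), of v]
      by simp
  qed simp_all
  show ?thesis
    unfolding strong_homotopy_equivalence_def
    using near far g'(5) \<psi>'(2) \<phi>'(5)
    by (intro conjI exI[of _ g'] exI[of _ \<phi>'] exI[of _ \<psi>']) simp_all
qed

text \<open>On the codomain \<open>I B\<close> the homotopy is the connection. On the pushout it is glued from the connection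
  on \<open>I I A\<close> and the contraction on \<open>I B\<close>, since \<open>I\<close> preserves the pushout; the two agree on \<open>I A\<close> because
  the connection collapses \<open>I \<delta>\<close> to the contraction. The inverse \<open>I B \<rightarrow> B\<close>, followed by the inclusion of \<open>B\<close>
  into the pushout, is what the connection leaves at the near end.\<close>

lemma she_leibniz_product:
  assumes \<epsilon>: "nat_trans C C I id_functor \<epsilon>" "\<And>X. X \<in> obj C \<Longrightarrow> \<epsilon> X \<cdot> \<delta> k X = idn C X"
      "\<And>X. X \<in> obj C \<Longrightarrow> \<epsilon> X \<cdot> \<delta> l X = idn C X"
    and c: "nat_trans C C (comp_functor I I) I c"
      "\<And>X. X \<in> obj C \<Longrightarrow> c X \<cdot> \<delta> k (fob I X) = \<delta> k X \<cdot> \<epsilon> X"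
      "\<And>X. X \<in> obj C \<Longrightarrow> c X \<cdot> far I (\<delta> k X) = \<delta> k X \<cdot> \<epsilon> X"
      "\<And>X. X \<in> obj C \<Longrightarrow> c X \<cdot> \<delta> l (fob I X) = idn C (fob I X)"
    and [simp]: "i \<in> arr C" and h: "is_leibniz_product C I \<delta> k i h"
  shows "she h"
proof -
  have [simp]: "\<epsilon> X \<in> arr C" "src C (\<epsilon> X) = fob I X" "tgt C (\<epsilon> X) = X" if "X \<in> obj C" for X
    using \<epsilon>(1) that unfolding nat_trans_def id_functor_def by auto
  have [simp]: "c X \<in> arr C" "src C (c X) = fob I (fob I X)" "tgt C (c X) = fob I X" if "X \<in> obj C" for X
    using c(1) that unfolding nat_trans_def comp_functor_def by auto
  let ?A = "src C i" and ?B = "tgt C i"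
  have \<epsilon>_nat: "\<epsilon> ?B \<cdot> far I i = i \<cdot> \<epsilon> ?A"
    using \<epsilon>(1) unfolding nat_trans_def id_functor_def by simp
  have c_nat: "c ?B \<cdot> far I (far I i) = far I i \<cdot> c ?A"
    using c(1) unfolding nat_trans_def comp_functor_def by simp
  obtain P p q where P: "is_pushout C (\<delta> k ?A) i P p q" and hP: "h \<in> hom C P (fob I ?B)"
      "h \<cdot> p = far I i" "h \<cdot> q = \<delta> k ?B"
    using h unfolding is_leibniz_product_def by blast
  note [simp] = pushoutD(4-9)[OF P] hP(1)[simplified]
  have pq: "p \<cdot> \<delta> k ?A = q \<cdot> i" by (rule pushoutD(10)[OF P])
  have Pobj [simp]: "P \<in> obj C" using tgt_obj[of p] by simp
  have IP: "is_pushout C (far I (\<delta> k ?A)) (far I i) (fob I P) (far I p) (far I q)"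
    by (rule preserves_pushout[OF P])
  have "(p \<cdot> c ?A) \<cdot> far I (\<delta> k ?A) = (q \<cdot> \<epsilon> ?B) \<cdot> far I i"
    using c(3)[of ?A] \<epsilon>_nat comp_left[OF pq, of "\<epsilon> ?A"] by simp
  then obtain \<phi> where \<phi>: "\<phi> \<in> arr C" "src C \<phi> = fob I P" "tgt C \<phi> = P" "\<phi> \<cdot> far I p = p \<cdot> c ?A"
      "\<phi> \<cdot> far I q = q \<cdot> \<epsilon> ?B"
    by (rule pushout_desc[OF IP, of "p \<cdot> c ?A" P "q \<cdot> \<epsilon> ?B", rotated 2]) simp_all
  note [simp] = \<phi>(1-3)
  have near: "\<phi> \<cdot> \<delta> k P = (q \<cdot> \<epsilon> ?B) \<cdot> h"
  proof (rule pushout_eqI[OF P])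
    show "(\<phi> \<cdot> \<delta> k P) \<cdot> p = ((q \<cdot> \<epsilon> ?B) \<cdot> h) \<cdot> p"
      using endpoint_natural[of p "fob I ?A"] comp_left[OF \<phi>(4), of "\<delta> k (fob I ?A)"] c(2)[of ?A] hP(2)
        \<epsilon>_nat comp_left[OF pq, of "\<epsilon> ?A"] by simp
    show "(\<phi> \<cdot> \<delta> k P) \<cdot> q = ((q \<cdot> \<epsilon> ?B) \<cdot> h) \<cdot> q"
      using endpoint_natural[of q ?B] comp_left[OF \<phi>(5), of "\<delta> k ?B"] hP(3) by simp
  qed simp_all
  have far: "\<phi> \<cdot> \<delta> l P = idn C P"
  proof (rule pushout_eqI[OF P])
    show "(\<phi> \<cdot> \<delta> l P) \<cdot> p = idn C P \<cdot> p"
      using opposite.endpoint_natural[of p "fob I ?A"] comp_left[OF \<phi>(4), of "\<delta> l (fob I ?A)"] c(4)[of ?A]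
      by simp
    show "(\<phi> \<cdot> \<delta> l P) \<cdot> q = idn C P \<cdot> q"
      using opposite.endpoint_natural[of q ?B] comp_left[OF \<phi>(5), of "\<delta> l ?B"] \<epsilon>(3)[of ?B] by simp
  qed simp_all
  have strong: "h \<cdot> \<phi> = c ?B \<cdot> far I h"
  proof (rule pushout_eqI[OF IP])
    show "(h \<cdot> \<phi>) \<cdot> far I p = (c ?B \<cdot> far I h) \<cdot> far I p"
      using \<phi>(4) comp_left[OF hP(2), of "c ?A"] c_nat far_comp[of p h] hP(2) by simp
    show "(h \<cdot> \<phi>) \<cdot> far I q = (c ?B \<cdot> far I h) \<cdot> far I q"
      using \<phi>(5) comp_left[OF hP(3), of "\<epsilon> ?B"] c(3)[of ?B] far_comp[of q h] hP(3) by simp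
  qed simp_all
  have "h \<cdot> (q \<cdot> \<epsilon> ?B) = c ?B \<cdot> \<delta> k (fob I ?B)"
    using comp_left[OF hP(3), of "\<epsilon> ?B"] c(2)[of ?B] by simp
  then show ?thesis
    unfolding strong_homotopy_equivalence_def
    using near far strong c(4)[of ?B]
    by (intro conjI exI[of _ "q \<cdot> \<epsilon> ?B"] exI[of _ \<phi>] exI[of _ "c ?B"]) simp_all
qed

end
section \<open>The Frobenius property\<close>

context cat
begin

lemma rlp_pullback:
  assumes L: "L \<subseteq> arr C" and p: "p \<in> rlp C L" and P: "is_pullback C y p M s w"
  shows "s \<in> rlp C L"
  unfolding rlp_def
proof (intro CollectI conjI ballI)
  note [simp] = pullbackD(1,2,4-9)[OF P]
  have [simp]: "tgt C p = tgt C y" using pullbackD(3)[OF P] by simp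
  have ys: "y \<cdot> s = p \<cdot> w" by (rule pullbackD(10)[OF P])
  show "s \<in> arr C" by simp
  fix i assume i: "i \<in> L"
  then have [simp]: "i \<in> arr C" using L by blast
  show "lifts_against C i s"
    unfolding lifts_against_def
  proof (intro allI impI)
    fix u v assume u: "u \<in> hom C (src C i) (src C s)" and v: "v \<in> hom C (tgt C i) (tgt C s)"
      and eq: "s \<cdot> u = v \<cdot> i"
    note [simp] = u[simplified] v[simplified]
    have "p \<cdot> (w \<cdot> u) = (y \<cdot> v) \<cdot> i"
      using comp_left[OF ys, of u] eq by simp
    moreover have "lifts_against C i p" using p i unfolding rlp_def by blast
    ultimately have "\<exists>h. h \<in> hom C (tgt C i) (src C p) \<and> h \<cdot> i = w \<cdot> u \<and> p \<cdot> h = y \<cdot> v"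
      unfolding lifts_against_def
      by (elim allE[where x = "w \<cdot> u"] allE[where x = "y \<cdot> v"]) simp
    then obtain h where h: "h \<in> hom C (tgt C i) (src C p)" "h \<cdot> i = w \<cdot> u" "p \<cdot> h = y \<cdot> v" by blast
    note [simp] = h(1)[simplified]
    obtain g where g: "g \<in> arr C" "src C g = tgt C i" "tgt C g = M" "s \<cdot> g = v" "w \<cdot> g = h"
      by (rule pullback_lift[OF P, of v "tgt C i" h]) (simp_all add: h(3))
    note [simp] = g(1-3)
    have "g \<cdot> i = u"
      by (rule pullback_eqI[OF P])
        (use comp_left[OF g(4), of i] comp_left[OF g(5), of i] eq h(2) in simp_all)
    then show "\<exists>h. h \<in> hom C (tgt C i) (src C s) \<and> h \<cdot> i = u \<and> s \<cdot> h = v"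
      using g(4) by (intro exI[of _ g]) simp
  qed
qed

end

context lcc_cat
begin

text \<open>Dependent product along \<open>p\<close> is right adjoint to pullback along \<open>p\<close>, so a lifting problem of a
  generator \<open>j\<close> against the dependent product of \<open>q\<close> is one of a pullback of \<open>j\<close> against \<open>q\<close>. That
  pullback is along a pullback of \<open>p\<close>.\<close>

lemma dependent_product_in_rlp:
  assumes G: "G \<subseteq> arr C"
    and gen: "\<And>j p P u v. j \<in> G \<Longrightarrow> p \<in> rlp C G \<Longrightarrow> is_pullback C j p P u v \<Longrightarrow> v \<in> llp C (rlp C G)"
    and p: "p \<in> rlp C G" and q: "q \<in> rlp C G" and dp: "is_dependent_product C p q r N s w ev"
  shows "r \<in> rlp C G"
  unfolding rlp_def
proof (intro CollectI conjI ballI)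
  have PN: "is_pullback C r p N s w" and ev: "ev \<in> hom C N (src C q)" "q \<cdot> ev = w"
    and qa: "q \<in> arr C" "tgt C q = src C p"
    and U: "\<forall>t M s' w' f. is_pullback C t p M s' w' \<longrightarrow> f \<in> hom C M (src C q) \<longrightarrow> q \<cdot> f = w' \<longrightarrow>
       (\<exists>!g. g \<in> hom C (src C t) (src C r) \<and> r \<cdot> g = t \<and>
         (\<exists>m. m \<in> hom C M N \<and> s \<cdot> m = g \<cdot> s' \<and> w \<cdot> m = w' \<and> ev \<cdot> m = f))"
    using dp unfolding is_dependent_product_def by blast+
  note [simp] = qa pullbackD(1,2,4-9)[OF PN] ev(1)[simplified]
  have [simp]: "tgt C p = tgt C r" using pullbackD(3)[OF PN] by simp
  show "r \<in> arr C" by simp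
  fix j assume j: "j \<in> G"
  then have [simp]: "j \<in> arr C" using G by blast
  show "lifts_against C j r"
    unfolding lifts_against_def
  proof (intro allI impI)
    fix x y assume x: "x \<in> hom C (src C j) (src C r)" and y: "y \<in> hom C (tgt C j) (tgt C r)"
      and rx: "r \<cdot> x = y \<cdot> j"
    note [simp] = x[simplified] y[simplified]
    obtain MD sD wD where PD: "is_pullback C y p MD sD wD"
      using pullback_exists[of y p] by auto
    note [simp] = pullbackD(4-9)[OF PD]
    have sD: "sD \<in> rlp C G" by (rule rlp_pullback[OF G p PD])
    obtain MC sC j' where PC: "is_pullback C j sD MC sC j'"
      using pullback_exists[of j sD] by auto
    note [simp] = pullbackD(4-9)[OF PC]
    have PYJ: "is_pullback C (y \<cdot> j) p MC sC (wD \<cdot> j')" by (rule pullback_paste[OF PD PC])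
    have "r \<cdot> (x \<cdot> sC) = p \<cdot> (wD \<cdot> j')"
      using comp_left[OF rx, of sC] pullbackD(10)[OF PYJ] by simp
    then obtain m where m: "m \<in> arr C" "src C m = MC" "tgt C m = N" "s \<cdot> m = x \<cdot> sC" "w \<cdot> m = wD \<cdot> j'"
      by (rule pullback_lift[OF PN, of "x \<cdot> sC" MC "wD \<cdot> j'", rotated 2]) simp_all
    note [simp] = m(1-3)
    have qf: "q \<cdot> (ev \<cdot> m) = wD \<cdot> j'"
      using comp_left[OF ev(2), of m] m(5) by simp
    have "lifts_against C j' q"
      using gen[OF j sD PC] q unfolding llp_def by blast
    then have "\<exists>h. h \<in> hom C (tgt C j') (src C q) \<and> h \<cdot> j' = ev \<cdot> m \<and> q \<cdot> h = wD"
      using qf unfolding lifts_against_def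
      by (elim allE[where x = "ev \<cdot> m"] allE[where x = wD]) simp
    then obtain h where h: "h \<in> hom C MD (src C q)" "h \<cdot> j' = ev \<cdot> m" "q \<cdot> h = wD" by auto
    note [simp] = h(1)[simplified]
    obtain g m' where g: "g \<in> hom C (src C y) (src C r)" "r \<cdot> g = y"
      and m': "m' \<in> hom C MD N" "s \<cdot> m' = g \<cdot> sD" "w \<cdot> m' = wD" "ev \<cdot> m' = h"
      using U[rule_format, OF PD h(1,3)] by (elim ex1E exE conjE) (rule that)
    note [simp] = g(1)[simplified] m'(1)[simplified]
    have "ev \<cdot> m \<in> hom C MC (src C q)" by simp
    from U[rule_format, OF PYJ this qf]
    have ex: "\<exists>!g. g \<in> hom C (src C (y \<cdot> j)) (src C r) \<and> r \<cdot> g = y \<cdot> j \<and>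
        (\<exists>k. k \<in> hom C MC N \<and> s \<cdot> k = g \<cdot> sC \<and> w \<cdot> k = wD \<cdot> j' \<and> ev \<cdot> k = ev \<cdot> m)" .
    have "m' \<cdot> j' \<in> hom C MC N \<and> s \<cdot> (m' \<cdot> j') = (g \<cdot> j) \<cdot> sC \<and> w \<cdot> (m' \<cdot> j') = wD \<cdot> j' \<and>
        ev \<cdot> (m' \<cdot> j') = ev \<cdot> m"
      using comp_left[OF m'(2), of j'] comp_left[OF m'(3), of j'] comp_left[OF m'(4), of j'] h(2)
        pullbackD(10)[OF PC] by simp
    moreover have "g \<cdot> j \<in> hom C (src C (y \<cdot> j)) (src C r) \<and> r \<cdot> (g \<cdot> j) = y \<cdot> j"
      using comp_left[OF g(2), of j] by simp
    moreover have "x \<in> hom C (src C (y \<cdot> j)) (src C r) \<and> r \<cdot> x = y \<cdot> j \<and> m \<in> hom C MC N \<and>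
        s \<cdot> m = x \<cdot> sC \<and> w \<cdot> m = wD \<cdot> j' \<and> ev \<cdot> m = ev \<cdot> m"
      using rx m by simp
    ultimately have "g \<cdot> j = x" using ex by blast
    then show "\<exists>h. h \<in> hom C (tgt C j) (src C r) \<and> h \<cdot> j = x \<and> r \<cdot> h = y"
      using g(2) by (intro exI[of _ g]) simp
  qed
qed

text \<open>By the same adjunction, a lifting problem of a pullback of \<open>i\<close> along \<open>p\<close> is one of \<open>i\<close> against a
  dependent product along \<open>p\<close>. So the Frobenius property has to be checked on generators only.\<close>

lemma frobenius_if_generators:
  assumes G: "G \<subseteq> arr C"
    and gen: "\<And>j p P u v. j \<in> G \<Longrightarrow> p \<in> rlp C G \<Longrightarrow> is_pullback C j p P u v \<Longrightarrow> v \<in> llp C (rlp C G)"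
  shows "frobenius C (llp C (rlp C G)) (rlp C G)"
  unfolding frobenius_def
proof (intro allI impI)
  fix i p P u v
  assume i: "i \<in> llp C (rlp C G)" and p: "p \<in> rlp C G" and P: "is_pullback C i p P u v"
  note [simp] = pullbackD(1,2,4-9)[OF P]
  have tp [simp]: "tgt C p = tgt C i" using pullbackD(3)[OF P] by simp
  have iu: "i \<cdot> u = p \<cdot> v" by (rule pullbackD(10)[OF P])
  show "v \<in> llp C (rlp C G)"
    unfolding llp_def
  proof (intro CollectI conjI ballI)
    show "v \<in> arr C" by simp
    fix q assume q: "q \<in> rlp C G"
    then have [simp]: "q \<in> arr C" unfolding rlp_def by blast
    show "lifts_against C v q"
      unfolding lifts_against_def
    proof (intro allI impI)
      fix a b assume a: "a \<in> hom C (src C v) (src C q)" and b: "b \<in> hom C (tgt C v) (tgt C q)"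
        and qa: "q \<cdot> a = b \<cdot> v"
      note [simp] = a[simplified] b[simplified]
      \<comment> \<open>It suffices to find a section, extending \<open>a\<close>, of the pullback \<open>q'\<close> of \<open>q\<close> along \<open>b\<close>.\<close>
      obtain Z q' z where PZ: "is_pullback C b q Z q' z"
        using pullback_exists[of b q] by auto
      note [simp] = pullbackD(4-9)[OF PZ]
      have q': "q' \<in> rlp C G" by (rule rlp_pullback[OF G q PZ])
      obtain a' where a': "a' \<in> arr C" "src C a' = P" "tgt C a' = Z" "q' \<cdot> a' = v" "z \<cdot> a' = a"
        by (rule pullback_lift[OF PZ, of v P a]) (simp_all add: qa)
      note [simp] = a'(1-3)
      obtain r N s w ev where dp: "is_dependent_product C p q' r N s w ev"
        by (rule dependent_product_exists[of p q']) (simp, simp, simp, rule that)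
      then have PN: "is_pullback C r p N s w" and ev: "ev \<in> hom C N (src C q')" "q' \<cdot> ev = w"
        and U: "\<forall>t M s' w' f. is_pullback C t p M s' w' \<longrightarrow> f \<in> hom C M (src C q') \<longrightarrow> q' \<cdot> f = w' \<longrightarrow>
          (\<exists>!g. g \<in> hom C (src C t) (src C r) \<and> r \<cdot> g = t \<and>
            (\<exists>m. m \<in> hom C M N \<and> s \<cdot> m = g \<cdot> s' \<and> w \<cdot> m = w' \<and> ev \<cdot> m = f))"
        unfolding is_dependent_product_def by blast+
      note [simp] = pullbackD(1,2,4-9)[OF PN] ev(1)[simplified]
      have [simp]: "tgt C r = tgt C i" using pullbackD(3)[OF PN] by simp
      have r: "r \<in> rlp C G" by (rule dependent_product_in_rlp[OF G gen p q' dp])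
      have "a' \<in> hom C P (src C q')" by simp
      from U[rule_format, OF P this a'(4)]
      obtain x m where x: "x \<in> hom C (src C i) (src C r)" "r \<cdot> x = i"
        and m: "m \<in> hom C P N" "s \<cdot> m = x \<cdot> u" "w \<cdot> m = v" "ev \<cdot> m = a'"
        by (elim ex1E exE conjE) (rule that)
      note [simp] = x(1)[simplified] m(1)[simplified]
      have "lifts_against C i r" using i r unfolding llp_def by blast
      then have "\<exists>h. h \<in> hom C (tgt C i) (src C r) \<and> h \<cdot> i = x \<and> r \<cdot> h = idn C (tgt C i)"
        using x(2) unfolding lifts_against_def
        by (elim allE[where x = x] allE[where x = "idn C (tgt C i)"]) simp
      then obtain g where g: "g \<in> hom C (tgt C i) (src C r)" "g \<cdot> i = x" "r \<cdot> g = idn C (tgt C i)"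
        by blast
      note [simp] = g(1)[simplified]
      have "r \<cdot> (g \<cdot> p) = p \<cdot> idn C (src C p)"
        using comp_left[OF g(3), of p] by simp
      then obtain n where n: "n \<in> arr C" "src C n = src C p" "tgt C n = N" "s \<cdot> n = g \<cdot> p"
          "w \<cdot> n = idn C (src C p)"
        by (rule pullback_lift[OF PN, of "g \<cdot> p" "src C p" "idn C (src C p)", rotated 2]) simp_all
      note [simp] = n(1-3)
      have "n \<cdot> v = m"
        by (rule pullback_eqI[OF PN])
          (use comp_left[OF n(4), of v] comp_left[OF n(5), of v] comp_left[OF g(2), of u] iu m(2,3)
            in simp_all)
      then have "ev \<cdot> (n \<cdot> v) = a'" using m(4) by simp
      moreover have "q' \<cdot> (ev \<cdot> n) = idn C (src C p)"
        using comp_left[OF ev(2), of n] n(5) by simp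
      moreover have "q \<cdot> (z \<cdot> (ev \<cdot> n)) = b \<cdot> (q' \<cdot> (ev \<cdot> n))"
        using comp_left[OF pullbackD(10)[OF PZ], of "ev \<cdot> n"] by simp
      ultimately show "\<exists>h. h \<in> hom C (tgt C v) (src C q) \<and> h \<cdot> v = a \<and> q \<cdot> h = b"
        using a'(5) by (intro exI[of _ "z \<cdot> (ev \<cdot> n)"]) simp
    qed
  qed
qed

end

theorem theorem3p8:
  fixes \<kappa> :: "'u rel"
    and E :: "('o, 'a) cat"
    and I :: "('o, 'a, 'o, 'a) cfunctor"
    and \<delta> :: "nat \<Rightarrow> 'o \<Rightarrow> 'a"
    and \<epsilon> :: "'o \<Rightarrow> 'a"
    and c :: "nat \<Rightarrow> 'o \<Rightarrow> 'a"
    and Cof TrivFib Gen TrivCof Fib :: "'a set"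
  assumes "smallness_cardinal \<kappa>"
    and "locally_presentable \<kappa> E"
    and "locally_cartesian_closed E"
    and "functorial_cylinder E I \<delta>"
    and "contraction E I \<delta> \<epsilon>"
    and "connections E I \<delta> \<epsilon> c"
    and "has_right_adjoint E E I"
    and "suitable \<kappa> E I \<delta> Cof TrivFib"
    and "cofibrantly_generated_by \<kappa> E Cof TrivFib Gen"
    and "Fib = rlp E (leibniz_products E I \<delta> Gen)"
    and "TrivCof = llp E Fib"
  shows "frobenius E TrivCof Fib"
proof -
  have cat: "category E" and cc: "cocomplete \<kappa> E"
    using assms(2) unfolding locally_presentable_def by blast+
  have I: "is_functor E E I" and \<delta>: "\<And>k. k \<in> {0, 1} \<Longrightarrow> nat_trans E E id_functor I (\<delta> k)"
    using assms(4) unfolding functorial_cylinder_def by blast+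
  interpret lcc_cat E
    by unfold_locales (fact cat assms(3))+
  interpret left_adjoint_endofunctor E I
    by unfold_locales (fact I assms(7))+
  have endpoint: "endpoint E I \<delta> k" if "k \<in> {0, 1}" for k
    by unfold_locales (fact \<delta>[OF that])
  have oriented: "oriented_cylinder E I \<delta> k (1 - k)" if "k \<in> {0, 1}" for k
    using endpoint[of k] endpoint[of "1 - k"] that by (auto simp: oriented_cylinder_def)
  have Gen: "Gen \<subseteq> arr E" and Cof: "Cof = llp E (rlp E Gen)"
    using assms(9) unfolding cofibrantly_generated_by_def wfs_def by blast+
  have Gen_Cof: "Gen \<subseteq> Cof"
    using Gen unfolding Cof llp_def rlp_def by blast
  have initial_Cof: "\<And>Z X f. is_initial E Z \<Longrightarrow> f \<in> hom E Z X \<Longrightarrow> f \<in> Cof"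
    and pullback_Cof: "\<And>i f P u v. i \<in> Cof \<Longrightarrow> is_pullback E i f P u v \<Longrightarrow> v \<in> Cof"
    and leibniz_Cof: "\<And>k i h. k \<in> {0, 1} \<Longrightarrow> i \<in> Cof \<Longrightarrow> is_leibniz_product E I \<delta> k i h \<Longrightarrow> h \<in> Cof"
    using assms(8) unfolding suitable_def by blast+
  let ?L = "leibniz_products E I \<delta> Gen"
  have L_arr: "?L \<subseteq> arr E"
    unfolding leibniz_products_def is_leibniz_product_def by auto
  \<comment> \<open>Fibrations have fillings for the boxes of every cofibration, not only of the generators.\<close>
  have fill: "fills_boxes E I (\<delta> k) i p" if k: "k \<in> {0, 1}" and i: "i \<in> Cof" and p: "p \<in> rlp E ?L" for k i p
  proof -
    interpret endpoint E I \<delta> k by (rule endpoint[OF k])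
    have p_arr: "p \<in> arr E" using p unfolding rlp_def by blast
    have "fills_boxes E I (\<delta> k) j p" if j: "j \<in> Gen" for j
    proof -
      have j_arr: "j \<in> arr E" using j Gen by blast
      obtain P r s where "is_pushout E (\<delta> k (src E j)) j P r s"
        using pushout_exists[OF assms(1) cc, of "\<delta> k (src E j)" j] j_arr by auto
      then obtain h where h: "is_leibniz_product E I \<delta> k j h"
        using leibniz_product_exists[OF j_arr] by blast
      then have "lifts_against E h p"
        using p k j unfolding rlp_def leibniz_products_def by blast
      then show ?thesis
        using fills_boxes_if_lifts_against_leibniz_product[OF h _ j_arr p_arr] by blast
    qed
    then show ?thesis
      using fills_boxes_extends_to_cofibrations[OF p_arr Gen] i Cof by blast
  qed
  have endpoint_lift: "lifts_against E (\<delta> k X) p" if k: "k \<in> {0, 1}" and X: "X \<in> obj E" and p: "p \<in> rlp E ?L" for k X p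
  proof -
    interpret endpoint E I \<delta> k by (rule endpoint[OF k])
    obtain Z where Z: "is_initial E Z"
      using initial_exists[OF assms(1) cc] by blast
    then obtain z where z: "z \<in> hom E Z X"
      using X unfolding is_initial_def by blast
    have "p \<in> arr E" using p unfolding rlp_def by blast
    then show ?thesis
      by (rule lifts_against_endpoint[OF Z z fill[OF k initial_Cof[OF Z z] p]])
  qed
  \<comment> \<open>A pullback \<open>v\<close> of a generator \<open>h\<close> is again a cofibration and a strong homotopy equivalence.\<close>
  have "v \<in> llp E (rlp E ?L)" if h: "h \<in> ?L" and p: "p \<in> rlp E ?L" and P: "is_pullback E h p P u v" for h p P u v
  proof -
    obtain k i where k: "k \<in> {0, 1}" and i: "i \<in> Gen" and leib: "is_leibniz_product E I \<delta> k i h"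
      using h unfolding leibniz_products_def by blast
    interpret oriented_cylinder E I \<delta> k "1 - k" by (rule oriented[OF k])
    have l: "1 - k \<in> {0, 1}" by auto
    have i_arr: "i \<in> arr E" using i Gen by blast
    have "h \<in> Cof" using leibniz_Cof[OF k _ leib] i Gen_Cof by blast
    then have v_Cof: "v \<in> Cof" using P by (rule pullback_Cof)
    have "she h"
    proof (rule she_leibniz_product[OF _ _ _ _ _ _ _ i_arr leib])
      show "nat_trans E E I id_functor \<epsilon>"
        and "\<And>X. X \<in> obj E \<Longrightarrow> \<epsilon> X \<cdot>\<^bsub>E\<^esub> \<delta> k X = idn E X"
        and "\<And>X. X \<in> obj E \<Longrightarrow> \<epsilon> X \<cdot>\<^bsub>E\<^esub> \<delta> (1 - k) X = idn E X"
        using assms(5) k l unfolding contraction_def by blast+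
      show "nat_trans E E (comp_functor I I) I (c k)"
        and "\<And>X. X \<in> obj E \<Longrightarrow> c k X \<cdot>\<^bsub>E\<^esub> \<delta> k (fob I X) = \<delta> k X \<cdot>\<^bsub>E\<^esub> \<epsilon> X"
        and "\<And>X. X \<in> obj E \<Longrightarrow> c k X \<cdot>\<^bsub>E\<^esub> far I (\<delta> k X) = \<delta> k X \<cdot>\<^bsub>E\<^esub> \<epsilon> X"
        and "\<And>X. X \<in> obj E \<Longrightarrow> c k X \<cdot>\<^bsub>E\<^esub> \<delta> (1 - k) (fob I X) = idn E (fob I X)"
        using assms(6) k unfolding connections_def by blast+
    qed
    moreover have "lifts_against E (\<delta> (1 - k) (src E p)) p"
      using endpoint_lift[OF l _ p] p unfolding rlp_def by simp
    ultimately have v: "she v"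
      by (rule she_pullback[OF _ P])
    show ?thesis
      unfolding llp_def
    proof (intro CollectI conjI ballI)
      show "v \<in> arr E" using v unfolding strong_homotopy_equivalence_def by blast
      fix q assume q: "q \<in> rlp E ?L"
      then have "q \<in> arr E" unfolding rlp_def by blast
      then show "lifts_against E v q"
        by (rule she_lifts_against[OF v fill[OF k v_Cof q]])
    qed
  qed
  then show ?thesis
    unfolding assms(10,11) by (rule frobenius_if_generators[OF L_arr])
qed

end
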